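(* Let $\pi=\langle\alpha,\beta,\gamma\mid\alpha\beta\gamma=1\rangle$ be the fundamental group of the pair of pants $\mathcal P$ (a sphere minus three points), so that $[S^1,\mathcal P]$ is identified with the set of conjugacy classes of $\pi$. Every essential class in $[S^1,\mathcal P]$ equals $L[w']$ for a normal loop word $w'$, and this normal loop word is unique up to shifting. Conversely, if a loop word $w'$ is normal, then the class $L[w']$ is essential.
   Context: A loop word of length $3\tau$ ($\tau\ge1$) is $w'=(w'_1,\dots,w'_{3\tau})=(l'_1,m'_1,n'_1,\dots,l'_\tau,m'_\tau,n'_\tau)\in\mathbb Z^{3\tau}$, with indices regarded cyclically in $\mathbb Z/3\tau$. $L[w']$ is the conjugacy class of $\alpha^{l'_1}\beta^{m'_1}\gamma^{n'_1}\cdots\alpha^{l'_\tau}\beta^{m'_\tau}\gamma^{n'_\tau}$ in $\pi$. The $1$-shift of $w'$ is $(l'_2,m'_2,n'_2,\dots,l'_\tau,m'_\tau,n'_\tau,l'_1,m'_1,n'_1)$, and shifting means iterating this. A class in $[S^1,\mathcal P]$ is essential if it is not the class of $\alpha^l$, $\beta^m$ or $\gamma^n$ for any $l,m,n\in\mathbb Z$. A loop word $w'$ is normal if (subwords being cyclically consecutive entries): (i) any subword $(a,1,b)$ satisfies $a,b\le0$; (ii) any subword $(a,0,b)$ satisfies ($a\le-1$ and $b\ge1$) or ($a\ge1$ and $b\le-1$) or ($a\ge1$ and $b\ge1$); (iii) there is no subword of the form $(0,-1,-1,\dots,-1,0)$; (iv) $w'\ne(-1,-1,\dots,-1)$. 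*)

theory Defs
  imports "HOL-Algebra.Group"
begin

section \<open>Groups given by generators and relators\<close>

text \<open>A word in the generators and their formal inverses: \<open>(x, True)\<close> stands for \<open>x\<close> and
  \<open>(x, False)\<close> for the inverse of \<open>x\<close>. The group presented by the generators \<open>'x\<close> and a set
  \<open>R\<close> of relators consists of the classes of words modulo the congruence generated by
  free cancellation and by deletion of relators.\<close>

type_synonym 'x gword = "('x \<times> bool) list"

inductive word_eq :: "'x gword set \<Rightarrow> 'x gword \<Rightarrow> 'x gword \<Rightarrow> bool" for R where
  refl: "word_eq R u u"
| sym: "word_eq R u v \<Longrightarrow> word_eq R v u"
| trans: "word_eq R u v \<Longrightarrow> word_eq R v w \<Longrightarrow> word_eq R u w"
| cancel: "word_eq R (u @ [(x, s), (x, \<not> s)] @ v) (u @ v)"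
| relator: "r \<in> R \<Longrightarrow> word_eq R (u @ r @ v) (u @ v)"

definition word_class :: "'x gword set \<Rightarrow> 'x gword \<Rightarrow> 'x gword set" where
  "word_class R u = {v. word_eq R u v}"

definition presented_group :: "'x gword set \<Rightarrow> ('x gword set) monoid" where
  "presented_group R =
     \<lparr>carrier = range (word_class R),
      mult = (\<lambda>A B. \<Union>a\<in>A. \<Union>b\<in>B. word_class R (a @ b)),
      one = word_class R []\<rparr>"

lemma word_class_eq_iff: "word_class R u = word_class R v \<longleftrightarrow> word_eq R u v"
proof
  assume "word_class R u = word_class R v"
  moreover have "v \<in> word_class R v" by (simp add: word_class_def word_eq.refl)
  ultimately have "v \<in> word_class R u" by simp
  then show "word_eq R u v" by (simp add: word_class_def)
next
  assume "word_eq R u v"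
  then show "word_class R u = word_class R v"
    unfolding word_class_def by (blast intro: word_eq.sym word_eq.trans)
qed

lemma word_eq_context: "word_eq R u v \<Longrightarrow> word_eq R (p @ u @ q) (p @ v @ q)"
proof (induction rule: word_eq.induct)
  case (cancel u x s v)
  show ?case using word_eq.cancel[of R "p @ u" x s "v @ q"] by simp
next
  case (relator r u v)
  then show ?case using word_eq.relator[of r R "p @ u" "v @ q"] by simp
qed (blast intro: word_eq.intros)+

lemma word_eq_append: "word_eq R u u' \<Longrightarrow> word_eq R v v' \<Longrightarrow> word_eq R (u @ v) (u' @ v')"
  using word_eq_context[of R u u' "[]" v] word_eq_context[of R v v' u' "[]"]
  by (auto intro: word_eq.trans)

lemma presented_group_mult:
  "word_class R u \<otimes>\<^bsub>presented_group R\<^esub> word_class R v = word_class R (u @ v)"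
proof -
  have eq: "word_class R (a @ b) = word_class R (u @ v)"
    if "a \<in> word_class R u" "b \<in> word_class R v" for a b
  proof -
    have "word_eq R (u @ v) (a @ b)"
      using that by (simp add: word_class_def word_eq_append)
    then show ?thesis by (simp add: word_class_eq_iff word_eq.sym)
  qed
  have "u \<in> word_class R u" "v \<in> word_class R v"
    by (simp_all add: word_class_def word_eq.refl)
  then have "(\<Union>a\<in>word_class R u. \<Union>b\<in>word_class R v. word_class R (a @ b)) = word_class R (u @ v)"
    using eq by blast
  then show ?thesis by (simp add: presented_group_def)
qed

definition inv_word :: "'x gword \<Rightarrow> 'x gword" where
  "inv_word u = rev (map (\<lambda>(x, s). (x, \<not> s)) u)"

lemma inv_word_left: "word_eq R (inv_word u @ u) []"
proof (induction u)
  case Nil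
  show ?case by (simp add: inv_word_def word_eq.refl)
next
  case (Cons y u)
  obtain x s where y: "y = (x, s)" by force
  have "word_eq R (inv_word u @ [(x, \<not> s), (x, \<not> \<not> s)] @ u) (inv_word u @ u)"
    by (rule word_eq.cancel)
  then show ?case using Cons word_eq.trans by (fastforce simp: y inv_word_def)
qed

lemma group_presented_group: "group (presented_group R)"
proof (rule groupI)
  let ?G = "presented_group R"
  have carrier: "carrier ?G = range (word_class R)" and one: "\<one>\<^bsub>?G\<^esub> = word_class R []"
    by (simp_all add: presented_group_def)
  show "x \<otimes>\<^bsub>?G\<^esub> y \<in> carrier ?G" if "x \<in> carrier ?G" "y \<in> carrier ?G" for x y
    using that by (auto simp: carrier presented_group_mult)
  show "\<one>\<^bsub>?G\<^esub> \<in> carrier ?G" by (simp add: carrier one)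
  show "x \<otimes>\<^bsub>?G\<^esub> y \<otimes>\<^bsub>?G\<^esub> z = x \<otimes>\<^bsub>?G\<^esub> (y \<otimes>\<^bsub>?G\<^esub> z)"
    if "x \<in> carrier ?G" "y \<in> carrier ?G" "z \<in> carrier ?G" for x y z
    using that by (auto simp: carrier presented_group_mult)
  show "\<one>\<^bsub>?G\<^esub> \<otimes>\<^bsub>?G\<^esub> x = x" if "x \<in> carrier ?G" for x
    using that by (auto simp: carrier one presented_group_mult)
  show "\<exists>y\<in>carrier ?G. y \<otimes>\<^bsub>?G\<^esub> x = \<one>\<^bsub>?G\<^esub>" if "x \<in> carrier ?G" for x
  proof -
    obtain u where u: "x = word_class R u" using \<open>x \<in> carrier ?G\<close> by (auto simp: carrier)
    have "word_class R (inv_word u) \<otimes>\<^bsub>?G\<^esub> x = \<one>\<^bsub>?G\<^esub>"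
      by (simp add: u one presented_group_mult word_class_eq_iff inv_word_left)
    then show ?thesis by (auto simp: carrier)
  qed
qed

definition conj_class :: "('a, 'b) monoid_scheme \<Rightarrow> 'a \<Rightarrow> 'a set" where
  "conj_class G g = {h \<otimes>\<^bsub>G\<^esub> g \<otimes>\<^bsub>G\<^esub> inv\<^bsub>G\<^esub> h | h. h \<in> carrier G}"

definition conj_classes :: "('a, 'b) monoid_scheme \<Rightarrow> 'a set set" where
  "conj_classes G = conj_class G ` carrier G"


section \<open>The fundamental group of the pair of pants\<close>

datatype pants_gen = Alpha | Beta | Gamma

definition pants_group :: "(pants_gen gword set) monoid" (\<open>\<pi>\<^sub>P\<close>) where
  "\<pi>\<^sub>P = presented_group {[(Alpha, True), (Beta, True), (Gamma, True)]}"

definition pants_elem :: "pants_gen \<Rightarrow> pants_gen gword set" where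
  "pants_elem x = word_class {[(Alpha, True), (Beta, True), (Gamma, True)]} [(x, True)]"

abbreviation "\<alpha> \<equiv> pants_elem Alpha"
abbreviation "\<beta> \<equiv> pants_elem Beta"
abbreviation "\<gamma> \<equiv> pants_elem Gamma"

lemma group_pants_group: "group \<pi>\<^sub>P"
  unfolding pants_group_def by (rule group_presented_group)

lemma pants_elem_closed: "pants_elem x \<in> carrier \<pi>\<^sub>P"
  by (simp add: pants_group_def pants_elem_def presented_group_def)

lemma pants_relation: "\<alpha> \<otimes>\<^bsub>\<pi>\<^sub>P\<^esub> \<beta> \<otimes>\<^bsub>\<pi>\<^sub>P\<^esub> \<gamma> = \<one>\<^bsub>\<pi>\<^sub>P\<^esub>"
  using word_eq.relator[of "[(Alpha, True), (Beta, True), (Gamma, True)]" _ "[]" "[]"]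
  by (simp add: pants_group_def pants_elem_def presented_group_mult)
    (simp add: presented_group_def word_class_eq_iff)

text \<open>The set of free homotopy classes of loops in the pair of pants, identified with the
  conjugacy classes of its fundamental group.\<close>

definition loop_classes :: "pants_gen gword set set set" where
  "loop_classes = conj_classes \<pi>\<^sub>P"

definition essential :: "pants_gen gword set set \<Rightarrow> bool" where
  "essential C \<longleftrightarrow>
     (\<forall>l::int. C \<noteq> conj_class \<pi>\<^sub>P (\<alpha> [^]\<^bsub>\<pi>\<^sub>P\<^esub> l)) \<and>
     (\<forall>m::int. C \<noteq> conj_class \<pi>\<^sub>P (\<beta> [^]\<^bsub>\<pi>\<^sub>P\<^esub> m)) \<and>
     (\<forall>n::int. C \<noteq> conj_class \<pi>\<^sub>P (\<gamma> [^]\<^bsub>\<pi>\<^sub>P\<^esub> n))"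


section \<open>Loop words\<close>

definition loop_word :: "int list \<Rightarrow> bool" where
  "loop_word w \<longleftrightarrow> (\<exists>\<tau>\<ge>1. length w = 3 * \<tau>)"

fun loop_elem :: "int list \<Rightarrow> pants_gen gword set" where
  "loop_elem (l # m # n # w) =
     \<alpha> [^]\<^bsub>\<pi>\<^sub>P\<^esub> l \<otimes>\<^bsub>\<pi>\<^sub>P\<^esub> \<beta> [^]\<^bsub>\<pi>\<^sub>P\<^esub> m \<otimes>\<^bsub>\<pi>\<^sub>P\<^esub> \<gamma> [^]\<^bsub>\<pi>\<^sub>P\<^esub> n \<otimes>\<^bsub>\<pi>\<^sub>P\<^esub> loop_elem w"
| "loop_elem _ = \<one>\<^bsub>\<pi>\<^sub>P\<^esub>" \<comment> \<open>only the empty list matters here, as lengths are multiples of 3\<close>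

definition loop_class :: "int list \<Rightarrow> pants_gen gword set set" where
  "loop_class w = conj_class \<pi>\<^sub>P (loop_elem w)"

definition one_shift :: "int list \<Rightarrow> int list" where
  "one_shift w = rotate 3 w"

definition equal_up_to_shifting :: "int list \<Rightarrow> int list \<Rightarrow> bool" where
  "equal_up_to_shifting v w \<longleftrightarrow> (\<exists>k. w = (one_shift ^^ k) v)"

text \<open>A subword consists of cyclically consecutive entries. Its length is not bounded by
  the length of \<open>w\<close>; in particular, two entries of a subword may come from the same
  position of \<open>w\<close>.\<close>

definition subword :: "int list \<Rightarrow> int list \<Rightarrow> bool" where
  "subword u w \<longleftrightarrow> (\<exists>i. u = map (\<lambda>j. w ! ((i + j) mod length w)) [0..<length u])"

definition normal :: "int list \<Rightarrow> bool" where
  "normal w \<longleftrightarrow>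
     (\<forall>a b. subword [a, 1, b] w \<longrightarrow> a \<le> 0 \<and> b \<le> 0) \<and>
     (\<forall>a b. subword [a, 0, b] w \<longrightarrow>
        (a \<le> -1 \<and> b \<ge> 1) \<or> (a \<ge> 1 \<and> b \<le> -1) \<or> (a \<ge> 1 \<and> b \<ge> 1)) \<and>
     (\<forall>k. \<not> subword ([0] @ replicate k (-1) @ [0]) w) \<and>
     w \<noteq> replicate (length w) (-1)"

end

theory Submission
  imports Defs
begin

text \<open>Put \<open>\<alpha> = rs\<close>, \<open>\<beta> = st\<close>, \<open>\<gamma> = tr\<close> with involutions \<open>r\<close>, \<open>s\<close>, \<open>t\<close>. This identifies the group with the
  elements of even length in the free product of three groups of order two, so a conjugacy class
  is a cyclically reduced word in \<open>r\<close>, \<open>s\<close>, \<open>t\<close> up to rotation by an even amount, that is, a cyclic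
  word in the six letters \<open>\<alpha>\<^sup>\<plusminus>, \<beta>\<^sup>\<plusminus>, \<gamma>\<^sup>\<plusminus>\<close>. For a normal loop word this cyclic word arises by
  replacing, between any two adjacent positive powers, one letter of each by the single negative
  letter \<open>\<alpha>\<beta> = \<gamma>\<inverse>\<close> (a junction). Conversely the types of neighbouring letters determine how many entries
  lie between them once the junctions among the negative letters are known. Two normal words
  which disagree on a junction disagree on the whole maximal run of negative letters around it,
  and the word that has no junctions there contains \<open>(0, -1, \<dots>, -1, 0)\<close> or equals \<open>(-1, \<dots>, -1)\<close>.

  A normal word in a given class is found by decreasing the length and then the sum of the
  absolute values: \<open>(a, 1, b) \<mapsto> (a - 1, 0, b - 1)\<close> and its inverse, \<open>(a, 0, 0, b) \<mapsto> (a + b)\<close>, and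
  \<open>(a, 0, -1, \<dots>, -1, 0, b) \<mapsto> (a + 1, 2, \<dots>, 2, b + 1)\<close> with one entry \<open>2\<close> fewer than entries \<open>-1\<close>.\<close>

section \<open>Conjugacy in the free product of groups of order two\<close>

fun nxt :: "pants_gen \<Rightarrow> pants_gen" where
  "nxt Alpha = Beta" | "nxt Beta = Gamma" | "nxt Gamma = Alpha"

lemma nxt_simps [simp]:
  "nxt (nxt (nxt t)) = t" "nxt t \<noteq> t" "t \<noteq> nxt t" "nxt (nxt t) \<noteq> t" "t \<noteq> nxt (nxt t)"
  "nxt s = nxt t \<longleftrightarrow> s = t"
  by (cases t; cases s; simp)+

lemma pants_gen_cases3: "s = t \<or> s = nxt t \<or> s = nxt (nxt t)"
  by (cases t; cases s; simp)

lemma funpow_nxt_mult3 [simp]: "(nxt ^^ (3 * n)) t = t"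
  by (induction n) (simp_all add: numeral_3_eq_3)

lemma funpow_nxt_mod3: "(nxt ^^ (n mod 3)) t = (nxt ^^ n) t"
proof -
  have "(nxt ^^ n) t = (nxt ^^ (n mod 3 + 3 * (n div 3))) t" by simp
  also have "\<dots> = (nxt ^^ (n mod 3)) t" unfolding funpow_add by simp
  finally show ?thesis by simp
qed

section \<open>Reduced words in a free product of groups of order two\<close>

definition inv_mult :: "'a \<Rightarrow> 'a list \<Rightarrow> 'a list" where
  "inv_mult i s = (case s of [] \<Rightarrow> [i] | j # s' \<Rightarrow> if i = j then s' else i # s)"

definition inv_reduce :: "'a list \<Rightarrow> 'a list" where
  "inv_reduce s = foldr inv_mult s []"

lemma distinct_adj_inv_mult [simp]: "distinct_adj s \<Longrightarrow> distinct_adj (inv_mult i s)"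
  by (cases s) (auto simp: inv_mult_def distinct_adj_Cons split: list.splits)

lemma inv_mult_twice [simp]: "distinct_adj s \<Longrightarrow> inv_mult i (inv_mult i s) = s"
  by (auto simp: inv_mult_def split: list.splits)

lemma distinct_adj_foldr_inv_mult [simp]:
  "distinct_adj s \<Longrightarrow> distinct_adj (foldr inv_mult u s)"
  by (induction u) auto

lemma distinct_adj_inv_reduce [simp]: "distinct_adj (inv_reduce s)"
  by (simp add: inv_reduce_def)

text \<open>Each letter acts on the reduced words as an involution, so cancelling a pair inside
  \<open>s\<close> does not change the action of \<open>s\<close>. This takes the place of a
  confluence argument.\<close>

lemma foldr_inv_reduce:
  assumes "distinct_adj r"
  shows "foldr inv_mult (inv_reduce s) r = foldr inv_mult s r"
proof (induction s)
  case Nil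
  show ?case by (simp add: inv_reduce_def)
next
  case (Cons i s)
  have "foldr inv_mult (inv_mult i q) r = inv_mult i (foldr inv_mult q r)" for q
    using assms by (cases q) (auto simp: inv_mult_def[of i "_ # _"] inv_mult_def[of i "[]"])
  with Cons show ?case by (simp add: inv_reduce_def)
qed

lemma inv_reduce_distinct_adj: "distinct_adj s \<Longrightarrow> inv_reduce s = s"
  by (induction s) (auto simp: inv_reduce_def inv_mult_def distinct_adj_Cons split: list.splits)

text \<open>Reduction works from the left. Its effect at the right end is found by letting the
  reduced word act on \<open>[i]\<close>, where only its last letter can cancel.\<close>

lemma inv_reduce_snoc:
  "inv_reduce (s @ [i]) =
     (if inv_reduce s \<noteq> [] \<and> last (inv_reduce s) = i then butlast (inv_reduce s)
      else inv_reduce s @ [i])"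
proof -
  have snoc: "foldr inv_mult q [i] = (if q \<noteq> [] \<and> last q = i then butlast q else q @ [i])"
    if "distinct_adj q" for q
    using that
  proof (induction q)
    case (Cons j q)
    show ?case
    proof (cases q)
      case (Cons l q')
      have IH: "foldr inv_mult q [i] = (if last q = i then butlast q else q @ [i])"
        using Cons.IH Cons.prems Cons by simp
      show ?thesis
      proof (cases "q' = []")
        case True
        then show ?thesis using Cons Cons.prems by (auto simp: inv_mult_def)
      next
        case False
        then have "foldr inv_mult q [i] = l # (if last q = i then butlast q' else q' @ [i])"
          using IH Cons by simp
        then have "foldr inv_mult (j # q) [i] = j # l # (if last q' = i then butlast q' else q' @ [i])"
          using Cons Cons.prems False by (simp only: foldr.simps o_apply) (simp add: inv_mult_def)
        then show ?thesis using Cons False by simp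
      qed
    qed (auto simp: inv_mult_def)
  qed simp
  have "inv_reduce (s @ [i]) = foldr inv_mult s [i]"
    by (simp add: inv_reduce_def inv_mult_def)
  also have "\<dots> = foldr inv_mult (inv_reduce s) [i]"
    by (simp add: foldr_inv_reduce)
  finally show ?thesis by (simp add: snoc)
qed

text \<open>Stripping equal end letters is conjugation by one involution, an element of odd length,
  hence the flipped flag. The length bound protects a single letter, whose two ends
  coincide.\<close>

function cyc_core :: "bool \<Rightarrow> 'a list \<Rightarrow> bool \<times> 'a list" where
  "cyc_core p s = (if length s \<ge> 2 \<and> hd s = last s then cyc_core (\<not> p) (butlast (tl s)) else (p, s))"
  by auto
termination by (relation "measure (length \<circ> snd)") auto

declare cyc_core.simps [simp del]

text \<open>The flag records the parity of the rotation, since only conjugation by elements of even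
  length is available in the group.\<close>

definition cyc_orbit :: "bool \<times> 'a list \<Rightarrow> (bool \<times> 'a list) set" where
  "cyc_orbit c = {(fst c \<noteq> odd k, rotate k (snd c)) | k. True}"

lemma cyc_orbit_rotate1: "cyc_orbit (p, rotate1 s) = cyc_orbit (\<not> p, s)"
proof
  show "cyc_orbit (p, rotate1 s) \<subseteq> cyc_orbit (\<not> p, s)"
  proof
    fix c assume "c \<in> cyc_orbit (p, rotate1 s)"
    then obtain k where "c = (p \<noteq> odd k, rotate k (rotate1 s))" by (auto simp: cyc_orbit_def)
    then have "c = ((\<not> p) \<noteq> odd (Suc k), rotate (Suc k) s)"
      by (auto simp: rotate1_rotate_swap)
    then show "c \<in> cyc_orbit (\<not> p, s)" unfolding cyc_orbit_def fst_conv snd_conv by blast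
  qed
  show "cyc_orbit (\<not> p, s) \<subseteq> cyc_orbit (p, rotate1 s)"
  proof
    fix c assume "c \<in> cyc_orbit (\<not> p, s)"
    then obtain k where c: "c = ((\<not> p) \<noteq> odd k, rotate k s)" by (auto simp: cyc_orbit_def)
    show "c \<in> cyc_orbit (p, rotate1 s)"
    proof (cases "s = []")
      case True
      then have "c = (p \<noteq> odd (k + 1), rotate (k + 1) (rotate1 s))" using c by auto
      then show ?thesis unfolding cyc_orbit_def fst_conv snd_conv by blast
    next
      case False
      \<comment> \<open>One rotation is undone by \<open>2 * length s - 1\<close> further ones.
        Unlike \<open>length s - 1\<close>, this number is always odd, as the flag requires.\<close>
      then obtain m where m: "2 * length s = Suc m" by (cases "2 * length s") auto
      then have "odd m" by presburger
      have "rotate (k + m) (rotate1 s) = rotate (k + 2 * length s) s"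
        unfolding m by (simp add: rotate1_rotate_swap)
      also have "\<dots> = rotate k s"
        by (metis mod_mult_self1 rotate_conv_mod)
      finally have "c = (p \<noteq> odd (k + m), rotate (k + m) (rotate1 s))" using c \<open>odd m\<close> by auto
      then show ?thesis unfolding cyc_orbit_def fst_conv snd_conv by blast
    qed
  qed
qed

definition conj_inv :: "bool \<Rightarrow> 'a list \<Rightarrow> (bool \<times> 'a list) set" where
  "conj_inv p s = cyc_orbit (cyc_core p (inv_reduce s))"

text \<open>Moving a letter from the front to the back is conjugation by it. If it cancels against
  exactly one end of the reduced rest, \<open>cyc_core\<close> strips it in the other word; if it
  cancels at both ends or at neither, the two words are rotations by one of each other.\<close>

lemma conj_inv_Cons: "conj_inv p (i # s) = conj_inv (\<not> p) (s @ [i])"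
proof -
  define t where "t = inv_reduce s"
  have t: "distinct_adj t" by (simp add: t_def)
  have L: "inv_reduce (i # s) = inv_mult i t" by (simp add: inv_reduce_def t_def)
  have R: "inv_reduce (s @ [i]) = (if t \<noteq> [] \<and> last t = i then butlast t else t @ [i])"
    by (simp add: inv_reduce_snoc t_def)
  have "cyc_orbit (cyc_core p (inv_mult i t)) =
        cyc_orbit (cyc_core (\<not> p) (if t \<noteq> [] \<and> last t = i then butlast t else t @ [i]))"
  proof (cases t)
    case Nil
    then show ?thesis using cyc_orbit_rotate1[of p "[i]"] by (simp add: inv_mult_def cyc_core.simps)
  next
    case (Cons j m)
    show ?thesis
    proof (cases "i = j")
      case True
      show ?thesis
      proof (cases "m = []")
        case True
        then show ?thesis using Cons \<open>i = j\<close> cyc_orbit_rotate1[of p "[]"]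
          by (simp add: inv_mult_def cyc_core.simps)
      next
        case False
        show ?thesis
        proof (cases "last m = i")
          case True
          have m: "m = butlast m @ [i]" using True False by (metis append_butlast_last_id)
          have "hd m \<noteq> i" using t Cons False \<open>i = j\<close> by (auto simp: distinct_adj_Cons)
          have "butlast m \<noteq> []" using \<open>hd m \<noteq> i\<close> m by (metis append_Nil list.sel(1))
          have "distinct_adj (butlast m @ [i])" using t Cons m by (metis distinct_adj_ConsD)
          then have "last (butlast m) \<noteq> i"
            using \<open>butlast m \<noteq> []\<close> by (simp add: distinct_adj_append_iff)
          have "cyc_core p m = (p, m)" using \<open>hd m \<noteq> i\<close> True by (simp add: cyc_core.simps)
          moreover have "cyc_core (\<not> p) (i # butlast m) = (\<not> p, i # butlast m)"
            using \<open>last (butlast m) \<noteq> i\<close> \<open>butlast m \<noteq> []\<close> by (simp add: cyc_core.simps)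
          moreover have "m = rotate1 (i # butlast m)" using m by simp
          ultimately show ?thesis
            using Cons True False \<open>i = j\<close> cyc_orbit_rotate1[of p "i # butlast m"]
            by (simp add: inv_mult_def)
        next
          case False
          have "cyc_core (\<not> p) (i # m @ [i]) = cyc_core p m"
            by (subst cyc_core.simps) simp
          then show ?thesis using Cons \<open>m \<noteq> []\<close> False \<open>i = j\<close> by (simp add: inv_mult_def)
        qed
      qed
    next
      case False
      show ?thesis
      proof (cases "last t = i")
        case True
        have "cyc_core p (i # t) = cyc_core (\<not> p) (butlast t)"
          using True Cons by (subst cyc_core.simps) (simp add: Suc_le_eq)
        then show ?thesis using Cons True False by (simp add: inv_mult_def)
      next
        case ne: False
        have "cyc_core p (i # t) = (p, i # t)" using Cons ne by (subst cyc_core.simps) simp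
        moreover have "cyc_core (\<not> p) (t @ [i]) = (\<not> p, t @ [i])"
          using Cons False by (subst cyc_core.simps) simp
        ultimately show ?thesis
          using Cons ne False cyc_orbit_rotate1[of "\<not> p" "i # t"] by (simp add: inv_mult_def)
      qed
    qed
  qed
  then show ?thesis by (simp add: conj_inv_def L R)
qed

lemma conj_inv_append: "conj_inv p (u @ v) = conj_inv (p \<noteq> odd (length u)) (v @ u)"
proof (induction u arbitrary: p v)
  case (Cons i u)
  have "conj_inv p ((i # u) @ v) = conj_inv (\<not> p) (u @ v @ [i])"
    using conj_inv_Cons[of p i "u @ v"] by simp
  also have "\<dots> = conj_inv ((\<not> p) \<noteq> odd (length u)) ((v @ [i]) @ u)" by (rule Cons.IH)
  finally show ?case by auto
qed simp

text \<open>Neither reduction changes such words, and equal flags force the rotation between them to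
  be even.\<close>

lemma conj_inv_cyc_reduced:
  assumes "conj_inv p s = conj_inv p s'"
    and "distinct_adj s" "hd s \<noteq> last s \<or> s = []" "distinct_adj s'" "hd s' \<noteq> last s' \<or> s' = []"
  obtains k where "s' = rotate (2 * k) s"
proof -
  have core: "cyc_core p t = (p, t)" if "hd t \<noteq> last t \<or> t = []" for t :: "'a list"
    using that by (subst cyc_core.simps) auto
  have "(p, s') \<in> cyc_orbit (p, s')"
    unfolding cyc_orbit_def by (rule CollectI, rule exI[of _ 0]) simp
  then have "(p, s') \<in> cyc_orbit (p, s)"
    using assms by (simp add: conj_inv_def core inv_reduce_distinct_adj)
  then obtain k where "even k" "s' = rotate k s" by (auto simp: cyc_orbit_def)
  then show ?thesis using that by (elim evenE) auto
qed

section \<open>Words of even length in the involutions as a model of the group\<close>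

abbreviation pants_relators :: "pants_gen gword set" where
  "pants_relators \<equiv> {[(Alpha, True), (Beta, True), (Gamma, True)]}"

abbreviation pclass :: "pants_gen gword \<Rightarrow> pants_gen gword set" where
  "pclass \<equiv> word_class pants_relators"

text \<open>The three involutions are named by the generators as well: each generator becomes the
  product of the involution of its own name and the cyclically next one.\<close>

fun refl_letter :: "pants_gen \<times> bool \<Rightarrow> pants_gen list" where
  "refl_letter (t, True) = [t, nxt t]"
| "refl_letter (t, False) = [nxt t, t]"

definition refl_word :: "pants_gen gword \<Rightarrow> pants_gen list" where
  "refl_word u = concat (map refl_letter u)"

lemma refl_word_simps [simp]:
  "refl_word [] = []" "refl_word (x # u) = refl_letter x @ refl_word u"
  "refl_word (u @ v) = refl_word u @ refl_word v"
  by (simp_all add: refl_word_def)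

lemma length_refl_letter [simp]: "length (refl_letter x) = 2"
  by (cases x rule: refl_letter.cases) auto

lemma length_refl_word [simp]: "length (refl_word u) = 2 * length u"
  by (induction u) auto

lemma refl_letter_inject: "refl_letter x = refl_letter y \<Longrightarrow> x = y"
  by (cases x rule: refl_letter.cases; cases y rule: refl_letter.cases) auto

lemma refl_word_inject: "refl_word u = refl_word v \<Longrightarrow> u = v"
proof (induction u arbitrary: v)
  case Nil
  then have "length v = 0" by (metis length_refl_word list.size(3) mult_is_0 zero_neq_numeral)
  then show ?case by simp
next
  case (Cons x u)
  then have "length v = Suc (length u)"
    by (metis length_Cons length_refl_word mult_cancel1 zero_neq_numeral)
  then obtain y v' where "v = y # v'" by (cases v) auto
  with Cons show ?case by (auto dest: refl_letter_inject)
qed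

lemma rotate_refl_word: "rotate (2 * k) (refl_word u) = refl_word (rotate k u)"
proof (induction k)
  case (Suc k)
  have two: "rotate 2 (refl_word v) = refl_word (rotate1 v)" for v
  proof (cases v)
    case (Cons x v')
    then show ?thesis using rotate_append[of "refl_letter x" "refl_word v'"] by simp
  qed simp
  have "rotate (2 * Suc k) (refl_word u) = rotate 2 (rotate (2 * k) (refl_word u))"
    by (simp add: rotate_rotate)
  then show ?case using Suc two by simp
qed simp

text \<open>The action on reduced words respects the relations: inverse letters cancel because
  involutions square to the identity, and the relator becomes r s s t t r.\<close>

lemma word_eq_refl_word:
  assumes "word_eq pants_relators u v" "distinct_adj r"
  shows "foldr inv_mult (refl_word u) r = foldr inv_mult (refl_word v) r"
  using assms
proof (induction arbitrary: r rule: word_eq.induct)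
  case (cancel u x s v)
  then show ?case by (cases s) auto
qed auto

definition pants_inv :: "pants_gen gword \<Rightarrow> (bool \<times> pants_gen list) set" where
  "pants_inv u = conj_inv True (refl_word u)"

lemma pants_inv_word_eq: "word_eq pants_relators u v \<Longrightarrow> pants_inv u = pants_inv v"
  by (simp add: pants_inv_def conj_inv_def inv_reduce_def word_eq_refl_word)

lemma pants_inv_append: "pants_inv (u @ v) = pants_inv (v @ u)"
  using conj_inv_append[of True "refl_word u" "refl_word v"] by (simp add: pants_inv_def)

lemma carrier_pants_group: "carrier \<pi>\<^sub>P = range pclass"
  by (simp add: pants_group_def presented_group_def)

lemma mult_pants_group: "pclass u \<otimes>\<^bsub>\<pi>\<^sub>P\<^esub> pclass v = pclass (u @ v)"
  by (simp add: pants_group_def presented_group_mult)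

lemma one_pants_group: "\<one>\<^bsub>\<pi>\<^sub>P\<^esub> = pclass []"
  by (simp add: pants_group_def presented_group_def)

interpretation pants: group "\<pi>\<^sub>P"
  by (rule group_pants_group)

lemma inv_pants_group: "inv\<^bsub>\<pi>\<^sub>P\<^esub> (pclass u) = pclass (inv_word u)"
  by (rule pants.inv_equality)
    (auto simp: carrier_pants_group mult_pants_group one_pants_group word_class_eq_iff inv_word_left)

lemma (in group) conj_class_eq_iff:
  assumes [simp]: "g \<in> carrier G" "g' \<in> carrier G"
  shows "conj_class G g = conj_class G g' \<longleftrightarrow> (\<exists>h\<in>carrier G. g' = h \<otimes> g \<otimes> inv h)"
proof
  assume eq: "conj_class G g = conj_class G g'"
  have "g' = \<one> \<otimes> g' \<otimes> inv \<one>" by simp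
  then have "g' \<in> conj_class G g'" unfolding conj_class_def by blast
  then show "\<exists>h\<in>carrier G. g' = h \<otimes> g \<otimes> inv h" using eq by (auto simp: conj_class_def)
next
  assume "\<exists>h\<in>carrier G. g' = h \<otimes> g \<otimes> inv h"
  then obtain h where h [simp]: "h \<in> carrier G" and g': "g' = h \<otimes> g \<otimes> inv h" by blast
  have "k \<otimes> g' \<otimes> inv k = (k \<otimes> h) \<otimes> g \<otimes> inv (k \<otimes> h)" if "k \<in> carrier G" for k
    using that by (simp add: g' inv_mult_group m_assoc)
  moreover have "k \<otimes> g \<otimes> inv k = (k \<otimes> inv h) \<otimes> g' \<otimes> inv (k \<otimes> inv h)" if "k \<in> carrier G" for k
  proof -
    have "inv h \<otimes> g' \<otimes> h = g"
      by (simp add: g' m_assoc) (simp add: m_assoc[symmetric])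
    have "(k \<otimes> inv h) \<otimes> g' \<otimes> inv (k \<otimes> inv h) = k \<otimes> (inv h \<otimes> g' \<otimes> h) \<otimes> inv k"
      using that by (simp add: inv_mult_group m_assoc)
    then show ?thesis using \<open>inv h \<otimes> g' \<otimes> h = g\<close> by simp
  qed
  ultimately show "conj_class G g = conj_class G g'"
    unfolding conj_class_def by (intro Collect_cong iffI) (metis h inv_closed m_closed)+
qed

lemma pants_inv_conj_class:
  assumes "conj_class \<pi>\<^sub>P (pclass u) = conj_class \<pi>\<^sub>P (pclass v)"
  shows "pants_inv u = pants_inv v"
proof -
  obtain p where "pclass v = pclass p \<otimes>\<^bsub>\<pi>\<^sub>P\<^esub> pclass u \<otimes>\<^bsub>\<pi>\<^sub>P\<^esub> inv\<^bsub>\<pi>\<^sub>P\<^esub> pclass p"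
    using assms pants.conj_class_eq_iff[of "pclass u" "pclass v"] by (auto simp: carrier_pants_group)
  then have "word_eq pants_relators v ((p @ u) @ inv_word p)"
    by (simp add: inv_pants_group mult_pants_group word_class_eq_iff)
  then have "pants_inv v = pants_inv ((inv_word p @ p) @ u)"
    using pants_inv_append[of "p @ u" "inv_word p"] by (simp add: pants_inv_word_eq)
  also have "\<dots> = pants_inv ([] @ u)"
    by (intro pants_inv_word_eq word_eq_append inv_word_left word_eq.refl)
  finally show ?thesis by simp
qed

text \<open>No involution may cancel between cyclic neighbours. This forbids \<alpha>\<beta> as well
  as \<alpha> followed by its inverse, since \<alpha>\<beta> shortens to the inverse of
  \<gamma>.\<close>

definition cyc_reduced :: "pants_gen gword \<Rightarrow> bool" where
  "cyc_reduced u \<longleftrightarrow> (\<forall>(x, y) \<in> set (zip u (rotate1 u)). last (refl_letter x) \<noteq> hd (refl_letter y))"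

lemma hd_refl_word [simp]: "u \<noteq> [] \<Longrightarrow> hd (refl_word u) = hd (refl_letter (hd u))"
  by (cases u) (auto simp: hd_append length_0_conv[symmetric] simp del: length_0_conv)

lemma last_refl_word [simp]: "u \<noteq> [] \<Longrightarrow> last (refl_word u) = last (refl_letter (last u))"
  by (cases u rule: rev_cases) (auto simp: last_append length_0_conv[symmetric] simp del: length_0_conv)

lemma cyc_reduced_refl_word:
  assumes "cyc_reduced u"
  shows "distinct_adj (refl_word u)" "hd (refl_word u) \<noteq> last (refl_word u) \<or> refl_word u = []"
proof -
  have dl: "distinct_adj (refl_letter x)" for x by (cases x rule: refl_letter.cases) auto
  have ne: "refl_letter x \<noteq> []" for x by (cases x rule: refl_letter.cases) auto
  have lin: "distinct_adj (refl_word v)"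
    if "\<forall>(x, y) \<in> set (zip v (tl v)). last (refl_letter x) \<noteq> hd (refl_letter y)" for v
    using that
  proof (induction v)
    case (Cons x v)
    then show ?case
      by (cases v) (auto simp: distinct_adj_append_iff dl ne hd_append)
  qed simp
  have snoc: "zip u (rotate1 u) = zip (butlast u) (tl u) @ [(last u, hd u)]" if "u \<noteq> []"
  proof -
    have "zip u (rotate1 u) = zip (butlast u @ [last u]) (tl u @ [hd u])"
      using that by (metis append_butlast_last_id list.collapse rotate1.simps(2))
    also have "\<dots> = zip (butlast u) (tl u) @ [(last u, hd u)]" by (subst zip_append) auto
    finally show ?thesis .
  qed
  have "set (zip u (tl u)) \<subseteq> set (zip u (rotate1 u))"
  proof (cases u)
    case (Cons x v)
    have "set (zip (butlast u) v) \<subseteq> set (zip u (rotate1 u))" using snoc Cons by auto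
    moreover have "zip u v = zip (butlast u) v"
      using zip_append1[of "butlast u" "[last u]" v] Cons append_butlast_last_id[of u]
      by (simp del: append_butlast_last_id butlast.simps last.simps)
    ultimately show ?thesis using Cons by simp
  qed simp
  then show "distinct_adj (refl_word u)" using assms lin[of u] unfolding cyc_reduced_def by blast
  show "hd (refl_word u) \<noteq> last (refl_word u) \<or> refl_word u = []"
  proof (cases u)
    case (Cons x v)
    then have "(last u, x) \<in> set (zip u (rotate1 u))" using snoc by simp
    then have "last (refl_letter (last u)) \<noteq> hd (refl_letter x)"
      using assms unfolding cyc_reduced_def by blast
    then show ?thesis using Cons hd_refl_word[of u] last_refl_word[of u] by (metis list.sel(1) list.distinct(1))
  qed simp
qed

text \<open>Every letter is a pair of involutions, so an even rotation of the word in the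
  involutions is a rotation of the letters.\<close>

proposition conj_class_cyc_reduced:
  assumes "conj_class \<pi>\<^sub>P (pclass u) = conj_class \<pi>\<^sub>P (pclass v)" "cyc_reduced u" "cyc_reduced v"
  obtains k where "v = rotate k u"
proof -
  have "conj_inv True (refl_word u) = conj_inv True (refl_word v)"
    using pants_inv_conj_class[OF assms(1)] by (simp add: pants_inv_def)
  then obtain k where "refl_word v = rotate (2 * k) (refl_word u)"
    using cyc_reduced_refl_word assms(2,3) conj_inv_cyc_reduced by metis
  then show ?thesis using that by (auto simp: rotate_refl_word dest: refl_word_inject)
qed

section \<open>Products along loop words\<close>

abbreviation pants_mult (infixl \<open>\<cdot>\<close> 70) where
  "g \<cdot> h \<equiv> g \<otimes>\<^bsub>\<pi>\<^sub>P\<^esub> h"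

lemma (in group) conj_class_mult_commute:
  assumes [simp]: "g \<in> carrier G" "h \<in> carrier G"
  shows "conj_class G (g \<otimes> h) = conj_class G (h \<otimes> g)"
proof -
  have "h \<otimes> g = h \<otimes> (g \<otimes> h) \<otimes> inv h" by (simp add: m_assoc)
  then show ?thesis using assms(2) by (subst conj_class_eq_iff) auto
qed

definition gen_pow :: "pants_gen \<Rightarrow> int \<Rightarrow> pants_gen gword set" where
  "gen_pow t k = pants_elem t [^]\<^bsub>\<pi>\<^sub>P\<^esub> k"

lemma gen_pow_closed [simp]: "gen_pow t k \<in> carrier \<pi>\<^sub>P"
  by (simp add: gen_pow_def pants_elem_closed)

lemma gen_pow_0 [simp]: "gen_pow t 0 = \<one>\<^bsub>\<pi>\<^sub>P\<^esub>"
  by (simp add: gen_pow_def)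

lemma gen_pow_add: "gen_pow t (j + k) = gen_pow t j \<cdot> gen_pow t k"
  by (simp add: gen_pow_def pants.int_pow_mult pants_elem_closed)

lemma gen_pow_mult [simp]: "gen_pow t j \<cdot> gen_pow t k = gen_pow t (j + k)"
  by (simp add: gen_pow_add)

lemma gen_pow_mult_left [simp]:
  "g \<in> carrier \<pi>\<^sub>P \<Longrightarrow> gen_pow t j \<cdot> (gen_pow t k \<cdot> g) = gen_pow t (j + k) \<cdot> g"
  by (simp add: pants.m_assoc[symmetric])

lemma inv_gen_pow: "inv\<^bsub>\<pi>\<^sub>P\<^esub> gen_pow t k = gen_pow t (- k)"
  by (simp add: gen_pow_def pants.int_pow_neg pants_elem_closed)

lemma gen_relation: "gen_pow t 1 \<cdot> gen_pow (nxt t) 1 \<cdot> gen_pow (nxt (nxt t)) 1 = \<one>\<^bsub>\<pi>\<^sub>P\<^esub>"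
proof -
  have step: "gen_pow (nxt s) 1 \<cdot> gen_pow (nxt (nxt s)) 1 \<cdot> gen_pow s 1 = \<one>\<^bsub>\<pi>\<^sub>P\<^esub>"
    if "gen_pow s 1 \<cdot> gen_pow (nxt s) 1 \<cdot> gen_pow (nxt (nxt s)) 1 = \<one>\<^bsub>\<pi>\<^sub>P\<^esub>" for s
    using that pants.inv_comm[of "gen_pow s 1" "gen_pow (nxt s) 1 \<cdot> gen_pow (nxt (nxt s)) 1"]
    by (simp add: pants.m_assoc)
  have 1: "gen_pow Alpha 1 \<cdot> gen_pow (nxt Alpha) 1 \<cdot> gen_pow (nxt (nxt Alpha)) 1 = \<one>\<^bsub>\<pi>\<^sub>P\<^esub>"
    using pants_relation by (simp add: gen_pow_def pants_elem_closed)
  show ?thesis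
    using 1 step[OF 1] step[of Beta] by (cases t) simp_all
qed

lemma gen_pow_neg_one: "gen_pow (nxt (nxt t)) (- 1) = gen_pow t 1 \<cdot> gen_pow (nxt t) 1"
  using pants.inv_equality[OF gen_relation[of t]] by (simp add: inv_gen_pow)

text \<open>The middle generator and one factor split off the left power multiply to the inverse of
  the third generator.\<close>

lemma gen_pow_pos_neg:
  "gen_pow t a \<cdot> gen_pow (nxt t) 1 \<cdot> gen_pow (nxt (nxt t)) b
     = gen_pow t (a - 1) \<cdot> gen_pow (nxt (nxt t)) (b - 1)"
proof -
  have "gen_pow t a \<cdot> gen_pow (nxt t) 1 \<cdot> gen_pow (nxt (nxt t)) b
      = gen_pow t (a - 1) \<cdot> (gen_pow t 1 \<cdot> gen_pow (nxt t) 1) \<cdot> gen_pow (nxt (nxt t)) b"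
    by (simp add: pants.m_assoc)
  also have "\<dots> = gen_pow t (a - 1) \<cdot> gen_pow (nxt (nxt t)) (b - 1)"
    by (simp add: gen_pow_neg_one[symmetric] pants.m_assoc)
  finally show ?thesis .
qed

text \<open>The type of the first entry is a parameter, so that words can be rotated by any amount
  and not only by multiples of three.\<close>

fun word_prod :: "pants_gen \<Rightarrow> int list \<Rightarrow> pants_gen gword set" where
  "word_prod t [] = \<one>\<^bsub>\<pi>\<^sub>P\<^esub>"
| "word_prod t (a # w) = gen_pow t a \<cdot> word_prod (nxt t) w"

lemma word_prod_closed [simp]: "word_prod t w \<in> carrier \<pi>\<^sub>P"
  by (induction t w rule: word_prod.induct) simp_all

lemma funpow_nxt_commute: "(nxt ^^ k) (nxt t) = nxt ((nxt ^^ k) t)"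
  by (simp add: funpow_swap1)

lemma word_prod_append:
  "word_prod t (u @ v) = word_prod t u \<cdot> word_prod ((nxt ^^ length u) t) v"
  by (induction t u rule: word_prod.induct) (simp_all add: pants.m_assoc funpow_nxt_commute)

definition word_conj :: "pants_gen \<Rightarrow> int list \<Rightarrow> pants_gen gword set set" where
  "word_conj t w = conj_class \<pi>\<^sub>P (word_prod t w)"

lemma three_dvd_Suc3 [simp]: "3 dvd Suc (Suc (Suc n)) \<longleftrightarrow> 3 dvd n"
  by presburger

lemma loop_class_eq_word_conj:
  assumes "3 dvd length w"
  shows "loop_class w = word_conj Alpha w"
proof -
  have "loop_elem w = word_prod Alpha w"
    using assms
  proof (induction w rule: loop_elem.induct)
    case (1 l m n w)
    have "3 dvd length w" using 1(2) by simp
    then show ?case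
      using 1(1) by (simp add: gen_pow_def pants_elem_closed pants.m_assoc)
  next
    case ("2_2" v)
    then show ?case by (auto dest: dvd_imp_le)
  next
    case ("2_3" v u)
    then show ?case by (auto dest: dvd_imp_le)
  qed simp
  then show ?thesis by (simp add: loop_class_def word_conj_def)
qed

text \<open>As the length is a multiple of three, the types return after a full turn, and an entry
  moved to the end keeps its type.\<close>

lemma word_conj_rotate:
  assumes "3 dvd length w"
  shows "word_conj ((nxt ^^ k) t) (rotate k w) = word_conj t w"
proof -
  have one: "word_conj (nxt s) (rotate1 v) = word_conj s v" if d: "3 dvd length v" for s v
  proof (cases v)
    case (Cons a u)
    obtain q where "length v = 3 * q" using d by (rule dvdE)
    then have "(nxt ^^ Suc (length u)) s = s" using Cons by (metis funpow_nxt_mult3 length_Cons)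
    then have "(nxt ^^ length u) (nxt s) = s" by (simp add: funpow_nxt_commute)
    then show ?thesis
      using Cons by (simp add: word_conj_def word_prod_append pants.conj_class_mult_commute)
  qed (simp add: word_conj_def)
  show ?thesis using assms by (induction k) (simp_all add: one)
qed

lemma not_essential_gen_pow: "\<not> essential (conj_class \<pi>\<^sub>P (gen_pow t k))"
  by (cases t) (auto simp: essential_def gen_pow_def)

text \<open>Each inverse generator is the product of the two generators that follow it cyclically.
  In a run the adjacent halves have the same type and merge into squares.\<close>

lemma word_prod_neg_run:
  "k \<ge> 1 \<Longrightarrow> word_prod (nxt (nxt t)) (replicate k (-1))
     = gen_pow t 1 \<cdot> word_prod (nxt t) (replicate (k - 1) 2) \<cdot> gen_pow ((nxt ^^ k) t) 1"
proof (induction k rule: dec_induct)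
  case base
  show ?case by (simp add: gen_pow_neg_one)
next
  case (step k)
  define s where "s = (nxt ^^ k) t"
  have l: "replicate (Suc k) (-1) = replicate k (-1) @ [-1::int]"
    by (simp add: replicate_append_same)
  have r: "replicate k 2 = replicate (k - 1) 2 @ [2::int]"
    using step(1) by (cases k) (simp_all add: replicate_append_same)
  have s': "(nxt ^^ (k - 1)) (nxt t) = s"
    using step(1) by (cases k) (simp_all add: s_def funpow_nxt_commute)
  have "word_prod (nxt (nxt t)) (replicate (Suc k) (-1))
      = word_prod (nxt (nxt t)) (replicate k (-1)) \<cdot> gen_pow (nxt (nxt s)) (-1)"
    unfolding l by (simp add: word_prod_append funpow_nxt_commute s_def)
  also have "\<dots> = gen_pow t 1 \<cdot> word_prod (nxt t) (replicate (k - 1) 2) \<cdot> gen_pow s 2 \<cdot> gen_pow (nxt s) 1"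
    unfolding step.IH gen_pow_neg_one by (simp add: s_def[symmetric] pants.m_assoc)
  also have "\<dots> = gen_pow t 1 \<cdot> word_prod (nxt t) (replicate k 2) \<cdot> gen_pow (nxt s) 1"
    unfolding r by (simp add: word_prod_append s'[simplified] pants.m_assoc)
  finally show ?case by (simp add: s_def)
qed

section \<open>Existence of normal words\<close>

lemma subword_iff:
  "subword u w \<longleftrightarrow> (\<exists>i. \<forall>j<length u. u ! j = w ! ((i + j) mod length w))"
proof -
  have list: "u = map h [0..<length u] \<longleftrightarrow> (\<forall>j<length u. u ! j = h j)" for h
    unfolding list_eq_iff_nth_eq by simp
  show ?thesis unfolding subword_def by (intro ex_cong1 list)
qed

lemma subword_of_rotate:
  assumes "subword u (rotate k w)"
  shows "subword u w"
proof (cases "w = []")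
  case False
  obtain i where i: "\<And>j. j < length u \<Longrightarrow> u ! j = rotate k w ! ((i + j) mod length w)"
    using assms by (auto simp: subword_iff)
  have "u ! j = w ! ((k + i + j) mod length w)" if "j < length u" for j
    using i[OF that] False by (simp add: nth_rotate mod_add_right_eq add.assoc)
  then show ?thesis unfolding subword_iff by (intro exI[of _ "k + i"]) simp
next
  case True
  then have "rotate k w = w" by simp
  then show ?thesis using assms by metis
qed

lemma subword_imp_prefix_rotate:
  assumes "subword u w" "length u \<le> length w"
  obtains k r where "rotate k w = u @ r"
proof -
  obtain i where i: "\<And>j. j < length u \<Longrightarrow> u ! j = w ! ((i + j) mod length w)"
    using assms(1) by (auto simp: subword_iff)
  have "take (length u) (rotate i w) = u"
  proof (rule nth_equalityI)
    show "length (take (length u) (rotate i w)) = length u" using assms(2) by simp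
    fix j assume "j < length (take (length u) (rotate i w))"
    then have "j < length u" "j < length w" by auto
    then show "take (length u) (rotate i w) ! j = u ! j" using i[of j] by (simp add: nth_rotate)
  qed
  then have "rotate i w = u @ drop (length u) (rotate i w)"
    using append_take_drop_id[of "length u" "rotate i w"] by simp
  then show ?thesis by (rule that)
qed

lemma normal_rotate:
  assumes "normal w"
  shows "normal (rotate k w)"
proof -
  have "rotate k w \<noteq> replicate (length (rotate k w)) (-1)"
  proof
    assume "rotate k w = replicate (length (rotate k w)) (-1)"
    then have "\<forall>x \<in> set (rotate k w). x = -1" by (metis in_set_replicate)
    then have "w = replicate (length w) (-1)" by (intro replicate_eqI) auto
    then show False using assms by (simp add: normal_def)
  qed
  moreover have "subword u (rotate k w) \<Longrightarrow> subword u w" for u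
    by (rule subword_of_rotate)
  ultimately show ?thesis using assms unfolding normal_def by meson
qed

section \<open>Moves that lower the length or the sum of absolute values\<close>

definition abs_sum :: "int list \<Rightarrow> nat" where
  "abs_sum w = nat (sum_list (map abs w))"

lemma abs_sum_rotate [simp]: "abs_sum (rotate k w) = abs_sum w"
proof -
  have "sum_list (map abs (rotate1 v)) = sum_list (map abs v)" for v :: "int list"
    by (cases v) simp_all
  then have "sum_list (map abs (rotate k w)) = sum_list (map abs w)" by (induction k) simp_all
  then show ?thesis by (simp add: abs_sum_def)
qed

lemma sum_list_abs_nonneg: "0 \<le> sum_list (map abs (w :: int list))"
  by (rule sum_list_nonneg) auto

text \<open>The order is lexicographic with the length first. The starting type \<open>s\<close> is
  free because the moves rotate the word, and \<open>v\<close> has to be nonempty to remain a loop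
  word.\<close>

definition conj_reduces :: "pants_gen \<Rightarrow> int list \<Rightarrow> bool" where
  "conj_reduces t w \<longleftrightarrow> (\<exists>s v. 3 dvd length v \<and> v \<noteq> [] \<and> word_conj s v = word_conj t w \<and>
     (v, w) \<in> measures [length, abs_sum])"

lemma conj_reduces_rotate:
  assumes "conj_reduces ((nxt ^^ k) t) (rotate k w)" "3 dvd length w"
  shows "conj_reduces t w"
  using assms word_conj_rotate[of w k t] by (auto simp: conj_reduces_def)

text \<open>At the same length, one outer entry is positive and drops by one, the other grows by at
  most one in absolute value, and the middle entry drops from 1 to 0.\<close>

lemma conj_reduces_positive:
  assumes "3 dvd length w" "w \<noteq> []" "subword [a, 1, b] w" "\<not> (a \<le> 0 \<and> b \<le> 0)"
  shows "conj_reduces t w"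
proof -
  have "3 \<le> length w" using assms(1,2) by (auto dest: dvd_imp_le)
  then obtain k r where w: "rotate k w = [a, 1, b] @ r"
    using subword_imp_prefix_rotate[OF assms(3)] by auto
  have len: "length w = length r + 3" using length_rotate[of k w] w by simp
  define v where "v = [a - 1, 0, b - 1] @ r"
  have "word_conj s v = word_conj s ([a, 1, b] @ r)" for s
    using gen_pow_pos_neg[of s a b] by (simp add: v_def word_conj_def pants.m_assoc[symmetric])
  moreover have "abs_sum v < abs_sum ([a, 1, b] @ r)"
    using assms(4) sum_list_abs_nonneg[of r] by (auto simp: abs_sum_def v_def)
  ultimately have "conj_reduces s ([a, 1, b] @ r)" for s
    unfolding conj_reduces_def using assms(1)[unfolded len]
    by (intro exI[of _ s] exI[of _ v]) (auto simp: v_def add.commute)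
  then show ?thesis using conj_reduces_rotate[of k t w] w assms(1) by simp
qed

text \<open>This is the inverse move: both outer entries drop in absolute value and only the middle
  one grows.\<close>

lemma conj_reduces_negative:
  assumes "3 dvd length w" "w \<noteq> []" "subword [a, 0, b] w" "a < 0" "b < 0"
  shows "conj_reduces t w"
proof -
  have "3 \<le> length w" using assms(1,2) by (auto dest: dvd_imp_le)
  then obtain k r where w: "rotate k w = [a, 0, b] @ r"
    using subword_imp_prefix_rotate[OF assms(3)] by auto
  have len: "length w = length r + 3" using length_rotate[of k w] w by simp
  define v where "v = [a + 1, 1, b + 1] @ r"
  have "word_conj s v = word_conj s ([a, 0, b] @ r)" for s
    using gen_pow_pos_neg[of s "a + 1" "b + 1"]
    by (simp add: v_def word_conj_def pants.m_assoc[symmetric])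
  moreover have "abs_sum v < abs_sum ([a, 0, b] @ r)"
    using assms(4,5) sum_list_abs_nonneg[of r] by (auto simp: abs_sum_def v_def)
  ultimately have "conj_reduces s ([a, 0, b] @ r)" for s
    unfolding conj_reduces_def using assms(1)[unfolded len]
    by (intro exI[of _ s] exI[of _ v]) (auto simp: v_def add.commute)
  then show ?thesis using conj_reduces_rotate[of k t w] w assms(1) by simp
qed

lemma word_conj_last_first:
  assumes "3 dvd Suc (length w)"
  shows "word_conj t (w @ [a]) = word_conj (nxt (nxt t)) (a # w)"
  using word_conj_rotate[of "a # w" 1 "nxt (nxt t)"] assms by simp

text \<open>The entries on the two sides of the zeros belong to the same generator and merge, so
  three entries disappear.\<close>

lemma conj_reduces_zero_zero:
  assumes "3 dvd length w" "w \<noteq> []" "subword [0, 0] w" "essential (word_conj t w)"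
  shows "conj_reduces t w"
proof -
  have "3 \<le> length w" using assms(1,2) by (auto dest: dvd_imp_le)
  then obtain k r where w: "rotate k w = [0, 0] @ r"
    using subword_imp_prefix_rotate[OF assms(3)] by auto
  define s where "s = (nxt ^^ k) t"
  have len: "length w = length r + 2" using length_rotate[of k w] w by simp
  have ess: "essential (word_conj s ([0, 0] @ r))"
    using assms(4) word_conj_rotate[OF assms(1), of k t] by (simp add: s_def w)
  have "r \<noteq> []" using len \<open>3 \<le> length w\<close> by auto
  then obtain c q' where r: "r = c # q'" by (cases r) auto
  \<comment> \<open>If a single entry remained besides the zeros, the class would be that of a power
    of one generator.\<close>
  have "q' \<noteq> []"
    using ess not_essential_gen_pow[of "nxt (nxt s)" c] by (auto simp: r word_conj_def)
  then obtain q d where q': "q' = q @ [d]" by (metis append_butlast_last_id)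
  define v where "v = (d + c) # q"
  have len': "length w = Suc (Suc (Suc (Suc (length q))))" using len r q' by simp
  then have d3: "3 dvd length v" using assms(1) len' by (simp add: v_def)
  have "word_conj s ([0, 0] @ r) = word_conj (nxt (nxt s)) (d # 0 # 0 # c # q)"
    using word_conj_last_first[of "0 # 0 # c # q" s d] assms(1) len' by (simp add: r q')
  also have "\<dots> = word_conj (nxt (nxt s)) v" by (simp add: word_conj_def v_def)
  finally have "conj_reduces s ([0, 0] @ r)"
    unfolding conj_reduces_def using len len' d3
    by (intro exI[of _ "nxt (nxt s)"] exI[of _ v]) (auto simp: v_def)
  then show ?thesis using conj_reduces_rotate[of k t w] w assms(1) by (simp add: s_def)
qed

text \<open>After \<open>word_prod_neg_run\<close> the two outer generators of the run have the
  types of the entries beyond the zeros and merge with them, so three entries disappear.\<close>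

lemma conj_reduces_neg_run:
  assumes "3 dvd length w" "w \<noteq> []" "subword ([0] @ replicate k (-1) @ [0]) w"
    "essential (word_conj t w)" "k \<ge> 1" "k + 2 \<le> length w"
  shows "conj_reduces t w"
proof -
  obtain l r where w: "rotate l w = ([0] @ replicate k (-1) @ [0]) @ r"
    using subword_imp_prefix_rotate[OF assms(3)] assms(6) by auto
  define s where "s = (nxt ^^ l) t"
  define u where "u = nxt (nxt s)"
  have len: "length w = k + 2 + length r" using length_rotate[of l w] w by simp
  have run: "word_prod (nxt (nxt u)) (replicate k (-1))
     = gen_pow u 1 \<cdot> word_prod (nxt u) (replicate (k - 1) 2) \<cdot> gen_pow ((nxt ^^ k) u) 1"
    by (rule word_prod_neg_run[OF assms(5)])
  show ?thesis
  proof (cases "r = []")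
    case True
    \<comment> \<open>The run and its zeros fill the whole cycle, so the zeros are adjacent across
      its end.\<close>
    have "subword [0, 0] (rotate l w)"
      unfolding subword_iff
    proof (rule exI[of _ "Suc k"], intro allI impI)
      fix j assume "j < length [0::int, 0]"
      then have "j = 0 \<or> j = 1" by auto
      then show "[0, 0] ! j = rotate l w ! ((Suc k + j) mod length (rotate l w))"
        using len True unfolding w by (auto simp: nth_append)
    qed
    then show ?thesis using assms conj_reduces_zero_zero subword_of_rotate by blast
  next
    case False
    then obtain r' a where r: "r = r' @ [a]" by (metis append_butlast_last_id)
    have first: "word_conj s (rotate l w) = word_conj u (a # 0 # replicate k (-1) @ 0 # r')"
      unfolding w u_def using word_conj_last_first[of "0 # replicate k (-1) @ 0 # r'" s a] assms(1) len
      by (simp add: r)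
    show ?thesis
    proof (cases r')
      case Nil
      \<comment> \<open>Both zeros border the same entry \<open>a\<close>, which therefore absorbs
        both outer generators.\<close>
      define v where "v = (a + 2) # replicate (k - 1) 2"
      have "length w = k + 3" using len r Nil by simp
      then have "3 dvd k" using assms(1) by simp
      then have u: "(nxt ^^ k) u = u" by (metis dvd_def funpow_nxt_mult3)
      have "word_conj s (rotate l w) = conj_class \<pi>\<^sub>P
          (gen_pow u (a + 1) \<cdot> word_prod (nxt u) (replicate (k - 1) 2) \<cdot> gen_pow u 1)"
        unfolding first by (simp add: Nil word_conj_def word_prod_append run u pants.m_assoc)
      also have "\<dots> = word_conj u v"
        by (subst pants.conj_class_mult_commute) (simp_all add: v_def word_conj_def add.commute)
      finally have "conj_reduces s (rotate l w)"
        unfolding conj_reduces_def using len r Nil \<open>3 dvd k\<close> assms(5)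
        by (intro exI[of _ u] exI[of _ v]) (auto simp: v_def)
      then show ?thesis using conj_reduces_rotate[of l t w] assms(1) by (simp add: s_def)
    next
      case (Cons b q)
      define v where "v = (a + 1) # replicate (k - 1) 2 @ (b + 1) # q"
      have k': "(nxt ^^ (k - 1)) (nxt u) = (nxt ^^ k) u"
        using assms(5) by (cases k) (simp_all add: funpow_nxt_commute)
      have lw: "length w = length v + 3" using len r Cons assms(5) by (simp add: v_def)
      have "v \<noteq> []" by (simp add: v_def)
      moreover have "3 dvd length v" using assms(1) lw by simp
      moreover have "word_conj s (rotate l w) = word_conj u v"
        unfolding first using k'
        by (simp add: Cons word_conj_def word_prod_append run v_def pants.m_assoc funpow_nxt_commute)
          (simp add: pants.m_assoc[symmetric] add.commute)
      ultimately have "conj_reduces s (rotate l w)"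
        unfolding conj_reduces_def using lw
        by (intro exI[of _ u] exI[of _ v]) auto
      then show ?thesis using conj_reduces_rotate[of l t w] assms(1) by (simp add: s_def)
    qed
  qed
qed

lemma subword_pairs:
  assumes "subword [a, b, c] w"
  shows "subword [a, b] w" "subword [b, c] w"
proof -
  obtain i where i: "\<forall>j<length [a, b, c]. [a, b, c] ! j = w ! ((i + j) mod length w)"
    using assms unfolding subword_iff by blast
  have "a = w ! ((i + 0) mod length w)" "b = w ! ((i + 1) mod length w)"
      "c = w ! ((i + 2) mod length w)"
    using i[rule_format, of 0] i[rule_format, of 1] i[rule_format, of 2] by simp_all
  moreover have "subword [w ! ((l + 0) mod length w), w ! ((l + 1) mod length w)] w" for l
    unfolding subword_iff by (rule exI[of _ l]) (simp add: less_Suc_eq nth_Cons')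
  from this[of i] this[of "i + 1"]
  have "subword [w ! ((i + 0) mod length w), w ! ((i + 1) mod length w)] w"
      "subword [w ! ((i + 1) mod length w), w ! ((i + 2) mod length w)] w"
    by (simp_all add: add.assoc)
  ultimately show "subword [a, b] w" "subword [b, c] w" by simp_all
qed

lemma subword_nth3:
  "subword [w ! (i mod length w), w ! ((i + 1) mod length w), w ! ((i + 2) mod length w)] w"
  unfolding subword_iff
proof (rule exI[of _ i], intro allI impI)
  fix j assume "j < length [w ! (i mod length w), w ! ((i + 1) mod length w), w ! ((i + 2) mod length w)]"
  then have "j = 0 \<or> j = 1 \<or> j = 2" by auto
  then show "[w ! (i mod length w), w ! ((i + 1) mod length w), w ! ((i + 2) mod length w)] ! j =
      w ! ((i + j) mod length w)"
    by (elim disjE) (simp_all del: One_nat_def add_Suc_right)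
qed

text \<open>A word without a decreasing move satisfies the conditions on subwords of length three.
  There remains a forbidden run too long for a move, whose closing zero is its opening zero reached
  again; then \<open>[-1, 0, -1]\<close> is a subword, against one of these conditions.\<close>

lemma conj_reduces_not_normal:
  assumes "3 dvd length w" "w \<noteq> []" "essential (word_conj t w)" "\<not> normal w"
    "w \<noteq> replicate (length w) (-1)"
  shows "conj_reduces t w"
proof (rule ccontr)
  assume irr: "\<not> conj_reduces t w"
  have len: "3 \<le> length w" using assms(1,2) by (auto dest: dvd_imp_le)
  have pos: "a \<le> 0 \<and> b \<le> 0" if "subword [a, 1, b] w" for a b
    using irr conj_reduces_positive[OF assms(1,2) that] by blast
  have zz: "\<not> subword [0, 0] w"
    using irr conj_reduces_zero_zero[OF assms(1,2) _ assms(3)] by blast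
  have zero: "(a \<le> -1 \<and> b \<ge> 1) \<or> (a \<ge> 1 \<and> b \<le> -1) \<or> (a \<ge> 1 \<and> b \<ge> 1)" if "subword [a, 0, b] w" for a b
  proof -
    have "a \<noteq> 0" "b \<noteq> 0" using zz subword_pairs[OF that] by auto
    moreover have "\<not> (a < 0 \<and> b < 0)"
      using irr conj_reduces_negative[OF assms(1,2) that] by blast
    ultimately show ?thesis by linarith
  qed
  have "\<exists>k. subword ([0] @ replicate k (-1) @ [0]) w"
    using assms(4,5) pos zero unfolding normal_def by blast
  then obtain k where k: "subword ([0] @ replicate k (-1) @ [0]) w" by blast
  have "k \<ge> 1" using k zz by (cases k) auto
  then have "length w < k + 2"
    using irr conj_reduces_neg_run[OF assms(1,2) k assms(3)] by (meson not_le)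
  obtain i where i: "\<And>j. j < k + 2 \<Longrightarrow>
      ([0] @ replicate k (-1) @ [0]) ! j = w ! ((i + j) mod length w)"
    using k by (auto simp: subword_iff)
  have i0: "w ! (i mod length w) = 0" using i[of 0] by simp
  have i1: "w ! ((i + j) mod length w) = -1" if "1 \<le> j" "j \<le> k" for j
    using i[of j] that by (cases j) (auto simp: nth_append)
  \<comment> \<open>A longer run would come back to the position of its opening zero, where the
    entry would be both 0 and -1.\<close>
  have "k < length w" using i0 i1[of "length w"] len by (cases "length w \<le> k") auto
  then have lw: "length w = Suc k" using \<open>length w < k + 2\<close> by simp
  have "w ! ((i + k + 2) mod length w) = w ! ((i + 1 + length w) mod length w)" by (simp add: lw)
  then have "w ! ((i + k + 2) mod length w) = -1"
    using i1[of 1] \<open>k \<ge> 1\<close> by (simp only: mod_add_self2)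
  moreover have "w ! ((i + k + 1) mod length w) = w ! ((i + length w) mod length w)" by (simp add: lw)
  then have "w ! ((i + k + 1) mod length w) = 0" using i0 by (simp only: mod_add_self2)
  ultimately have "subword [-1, 0, -1] w"
    using subword_nth3[of w "i + k"] i1[of k] \<open>k \<ge> 1\<close> by simp
  then show False using zero by fastforce
qed

text \<open>The splitting of \<open>word_prod_neg_run\<close> closes up around the cycle. It keeps
  the length and raises the absolute sum, so this word stands outside the descent; its image is
  already normal.\<close>

lemma word_conj_neg_ones:
  assumes "3 dvd k" "k \<noteq> 0"
  shows "word_conj t (replicate k (-1)) = word_conj (nxt t) (replicate k 2)"
proof -
  define u where "u = nxt t"
  have u: "(nxt ^^ k) u = u" using assms(1) by (metis dvd_def funpow_nxt_mult3)
  have "word_prod t (replicate k (-1)) = gen_pow u 1 \<cdot> word_prod (nxt u) (replicate (k - 1) 2) \<cdot> gen_pow u 1"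
    using word_prod_neg_run[of k u] assms(2) by (simp add: u_def[symmetric] u) (simp add: u_def)
  then have "word_conj t (replicate k (-1)) =
      conj_class \<pi>\<^sub>P (gen_pow u 1 \<cdot> (gen_pow u 1 \<cdot> word_prod (nxt u) (replicate (k - 1) 2)))"
    by (subst pants.conj_class_mult_commute[symmetric]) (simp_all add: word_conj_def pants.m_assoc)
  also have "\<dots> = word_conj u (replicate k 2)"
    using assms(2) by (cases k) (simp_all add: word_conj_def)
  finally show ?thesis by (simp add: u_def)
qed

lemma normal_twos: "k \<ge> 1 \<Longrightarrow> normal (replicate k 2)"
proof -
  assume k: "k \<ge> 1"
  have "set u \<subseteq> {2}" if u: "subword u (replicate k 2)" for u :: "int list"
  proof -
    obtain i where "u = map (\<lambda>j. replicate k 2 ! ((i + j) mod k)) [0..<length u]"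
      using u by (auto simp: subword_def)
    also have "\<dots> = map (\<lambda>j. 2) [0..<length u]"
      using k by (intro map_cong) auto
    finally show ?thesis by (metis (no_types, lifting) image_subsetI insertI1 set_map)
  qed
  then show ?thesis using k unfolding normal_def by (fastforce simp: replicate_eq_replicate)
qed

proposition exists_normal:
  assumes "3 dvd length w" "w \<noteq> []" "essential (word_conj t w)"
  shows "\<exists>s v. 3 dvd length v \<and> v \<noteq> [] \<and> normal v \<and> word_conj s v = word_conj t w"
  using assms
proof (induction w arbitrary: t rule: wf_induct_rule[OF wf_measures[of "[length, abs_sum]"]])
  case (1 w)
  show ?case
  proof (cases "w = replicate (length w) (-1)")
    case True
    have "word_conj (nxt t) (replicate (length w) 2) = word_conj t w"
      using word_conj_neg_ones[of "length w" t] 1(2,3) True by simp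
    then show ?thesis
      using 1(2,3) normal_twos[of "length w"]
      by (intro exI[of _ "nxt t"] exI[of _ "replicate (length w) 2"]) (auto simp: Suc_le_eq)
  next
    case False
    show ?thesis
    proof (cases "normal w")
      case True
      then show ?thesis using 1(2,3) by blast
    next
      case nn: False
      obtain s v where "3 dvd length v" "v \<noteq> []" "word_conj s v = word_conj t w"
        "(v, w) \<in> measures [length, abs_sum]"
        using conj_reduces_not_normal[OF 1(2,3,4) nn False] by (auto simp: conj_reduces_def)
      then show ?thesis using 1(1)[of v s] 1(4) by simp
    qed
  qed
qed

section \<open>Cyclic words with marked junctions\<close>

fun links :: "'a \<Rightarrow> 'a list \<Rightarrow> ('a \<times> 'a) list" where
  "links x [] = []"
| "links x (y # ys) = (x, y) # links y ys"

definition cyc_pairs :: "'a list \<Rightarrow> ('a \<times> 'a) list" where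
  "cyc_pairs s = zip s (rotate1 s)"

lemma links_append: "links x (ys @ zs) = links x ys @ links (last (x # ys)) zs"
  by (induction x ys rule: links.induct) auto

lemma cyc_pairs_Cons: "cyc_pairs (x # xs) = links x (xs @ [x])"
proof -
  have "zip (y # ys) (ys @ [z]) = links y (ys @ [z])" for y z :: 'a and ys
    by (induction y ys rule: links.induct) auto
  then show ?thesis by (simp add: cyc_pairs_def)
qed

lemma cyc_pairs_rotate: "cyc_pairs (rotate k s) = rotate k (cyc_pairs s)"
proof -
  have zip: "zip (rotate1 a) (rotate1 b) = rotate1 (zip a b)" if "length a = length b" for a b :: "'a list"
    using that by (cases a; cases b) auto
  show ?thesis by (induction k) (simp_all add: cyc_pairs_def zip)
qed

lemma cyc_pairs_map: "cyc_pairs (map h s) = map (map_prod h h) (cyc_pairs s)"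
  by (simp add: cyc_pairs_def rotate1_map zip_map_map map_prod_def split_def)

lemma set_cyc_pairsD:
  assumes "(p, q) \<in> set (cyc_pairs s)"
  shows "p \<in> set s" "q \<in> set s"
  using assms by (auto simp: cyc_pairs_def dest: set_zip_leftD set_zip_rightD)

lemma rotate_inverse: "\<exists>l. rotate l (rotate m xs) = xs"
proof (cases "xs = []")
  case False
  then have "m \<le> m * length xs" by (simp add: Suc_le_eq)
  then have "rotate (m * length xs - m) (rotate m xs) = rotate (m * length xs) xs"
    by (simp add: rotate_rotate)
  then show ?thesis by (metis mod_mult_self2_is_0 rotate_id)
qed simp

lemma rotate_concat: "\<exists>m. concat (rotate k L) = rotate m (concat L)"
proof (induction k)
  case 0
  show ?case by (rule exI[of _ 0]) simp
next
  case (Suc k)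
  have "\<exists>m. concat (rotate1 M) = rotate m (concat M)" for M :: "'a list list"
  proof (cases M)
    case (Cons c M')
    then show ?thesis using rotate_append[of c "concat M'"] by (intro exI[of _ "length c"]) simp
  qed auto
  then show ?case using Suc by (metis rotate_Suc rotate_rotate)
qed

datatype mark = Pos | Neg | Junc

text \<open>\<open>Junc\<close> at type \<open>t\<close> is the inverse generator that arises between two positive powers,
  of \<open>t\<close> and of the next generator.\<close>

type_synonym mletter = "pants_gen \<times> mark"

fun unmark :: "mletter \<Rightarrow> pants_gen \<times> bool" where
  "unmark (t, Pos) = (t, True)"
| "unmark (t, Neg) = (t, False)"
| "unmark (t, Junc) = (nxt (nxt t), False)"

text \<open>These are the neighbours met when a normal word is read: inside an entry, from an entry
  to the next one, or across a zero. Adjacent positive entries are always joined by a junction, and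
  two negative entries are never separated by a single zero.\<close>

fun adj :: "mletter \<Rightarrow> mletter \<Rightarrow> bool" where
  "adj (s, k) (t, l) \<longleftrightarrow>
     (if t = s then (k, l) \<in> {(Pos, Pos), (Neg, Neg), (Pos, Junc)}
      else if t = nxt s then (k, l) \<in> {(Junc, Pos), (Junc, Junc), (Pos, Neg), (Neg, Neg), (Neg, Pos)}
      else (k, l) \<in> {(Pos, Pos), (Pos, Neg), (Neg, Pos)})"

lemma adj_reduced: "adj X Y \<Longrightarrow> last (refl_letter (unmark X)) \<noteq> hd (refl_letter (unmark Y))"
  using pants_gen_cases3[of "fst Y" "fst X"]
  by (cases X rule: unmark.cases; cases Y rule: unmark.cases) (auto split: if_splits)

text \<open>A loop word is written as its letters with a separator in front of every entry. \<open>Carry\<close>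
  follows the separator when a junction precedes it, so that an entry can be read off its own
  chunk.\<close>

datatype sym = Sep pants_gen | Carry | Letter mletter

text \<open>Two zeros in a row do not occur in a normal word, so the type difference of neighbouring
  letters, 0, 1 or 2, is the number of entries begun between them.\<close>

fun gap :: "mletter \<Rightarrow> mletter \<Rightarrow> sym list" where
  "gap (s, k) (t, l) =
     (if t = s then [] else if t = nxt s then Sep t # (if k = Junc then [Carry] else [])
      else [Sep (nxt s), Sep t])"

definition spell :: "(mletter \<times> mletter) list \<Rightarrow> sym list" where
  "spell ps = concat (map (\<lambda>(X, Y). gap X Y @ [Letter Y]) ps)"

lemma spell_simps [simp]:
  "spell [] = []" "spell ((X, Y) # ps) = gap X Y @ Letter Y # spell ps"
  "spell (ps @ qs) = spell ps @ spell qs"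
  by (simp_all add: spell_def)

lemma spell_rotate: "\<exists>m. spell (rotate k ps) = rotate m (spell ps)"
  unfolding spell_def rotate_map[symmetric] by (rule rotate_concat)

definition all_adj :: "(mletter \<times> mletter) list \<Rightarrow> bool" where
  "all_adj ps \<longleftrightarrow> (\<forall>(X, Y) \<in> set ps. adj X Y)"

lemma all_adj_simps [simp]:
  "all_adj []" "all_adj ((X, Y) # ps) \<longleftrightarrow> adj X Y \<and> all_adj ps"
  "all_adj (ps @ qs) \<longleftrightarrow> all_adj ps \<and> all_adj qs"
  "all_adj (rotate k ps) \<longleftrightarrow> all_adj ps"
  by (auto simp: all_adj_def)

section \<open>Uniqueness of the decomposition into chunks\<close>

definition is_chunk :: "sym list \<Rightarrow> bool" where
  "is_chunk c \<longleftrightarrow> (\<exists>t b. c = Sep t # b \<and> (\<forall>u. Sep u \<notin> set b))"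

definition at_sep :: "sym list \<Rightarrow> bool" where
  "at_sep s \<longleftrightarrow> s = [] \<or> (\<exists>t s'. s = Sep t # s')"

lemma at_sep_simps [simp]: "at_sep []" "at_sep (Sep t # s)"
  by (simp_all add: at_sep_def)

lemma is_chunk_append:
  assumes "is_chunk (p @ us)" "p \<noteq> []" "at_sep (us @ s)"
  shows "us = []"
  using assms by (cases p; cases us) (auto simp: is_chunk_def at_sep_def)

lemma at_sep_concat: "\<forall>c \<in> set L. is_chunk c \<Longrightarrow> at_sep (concat L)"
  by (cases L) (auto simp: is_chunk_def)

lemma is_chunk_nonempty: "is_chunk c \<Longrightarrow> c \<noteq> []"
  by (auto simp: is_chunk_def)

text \<open>Inside a chunk there is no further separator, so a cut in front of a separator falls
  between two chunks.\<close>

lemma concat_chunks_split: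
  assumes "\<forall>c \<in> set L. is_chunk c" "concat L = p @ q" "at_sep q"
  shows "\<exists>L1 L2. L = L1 @ L2 \<and> concat L1 = p \<and> concat L2 = q"
  using assms
proof (induction L arbitrary: p)
  case (Cons d L)
  show ?case
  proof (cases "p = []")
    case True
    then show ?thesis using Cons.prems by (intro exI[of _ "[]"] exI[of _ "d # L"]) simp
  next
    case False
    have "d @ concat L = p @ q" using Cons.prems by simp
    then consider us where "d = p @ us" "us @ concat L = q" | us where "d @ us = p" "concat L = us @ q"
      by (auto simp: append_eq_append_conv2)
    then show ?thesis
    proof cases
      case 1
      then have "us = []" using is_chunk_append[of p us "concat L"] Cons.prems False by simp
      then show ?thesis using 1 by (intro exI[of _ "[d]"] exI[of _ L]) simp
    next
      case 2
      then obtain L1 L2 where "L = L1 @ L2" "concat L1 = us" "concat L2 = q"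
        using Cons.IH[of us] Cons.prems by auto
      then show ?thesis using 2 by (intro exI[of _ "d # L1"] exI[of _ L2]) simp
    qed
  qed
qed simp

lemma concat_chunks_inject:
  assumes "\<forall>c \<in> set L. is_chunk c" "\<forall>c \<in> set L'. is_chunk c" "concat L = concat L'"
  shows "L = L'"
  using assms
proof (induction L' arbitrary: L)
  case Nil
  then show ?case by (cases L) (auto simp: is_chunk_def)
next
  case (Cons c L')
  have c: "c \<noteq> []" "is_chunk c" using Cons.prems is_chunk_nonempty by auto
  then obtain d M where L: "L = d # M" using Cons.prems by (cases L) auto
  have d: "d \<noteq> []" "is_chunk d" using Cons.prems L is_chunk_nonempty by auto
  have seps: "at_sep (concat M)" "at_sep (concat L')"
    using Cons.prems L by (auto intro: at_sep_concat)
  have "d @ concat M = c @ concat L'" using Cons.prems L by simp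
  then consider us where "d = c @ us" "us @ concat M = concat L'"
    | us where "d @ us = c" "concat M = us @ concat L'"
    by (auto simp: append_eq_append_conv2)
  then have "d = c \<and> concat M = concat L'"
  proof cases
    case 1
    then show ?thesis using is_chunk_append[of c us "concat M"] c d seps by auto
  next
    case 2
    then show ?thesis using is_chunk_append[of d us "concat L'"] c d seps by auto
  qed
  then show ?case using Cons L by auto
qed

lemma concat_chunks_rotate:
  assumes "\<forall>c \<in> set L. is_chunk c" "at_sep (rotate m (concat L))"
  shows "\<exists>j. rotate m (concat L) = concat (rotate j L)"
proof (cases "concat L = []")
  case True
  then have "rotate m (concat L) = concat (rotate 0 L)" by (simp del: concat_eq_Nil_conv)
  then show ?thesis by blast
next
  case False
  define k where "k = m mod length (concat L)"
  define p where "p = take k (concat L)"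
  define q where "q = drop k (concat L)"
  have rot: "rotate m (concat L) = q @ p" by (simp add: rotate_drop_take k_def p_def q_def)
  have "k < length (concat L)" using False unfolding k_def by (meson length_greater_0_conv mod_less_divisor)
  then have "q \<noteq> []" by (simp add: q_def)
  then have "at_sep q" using assms(2) rot by (cases q) (auto simp: at_sep_def)
  moreover have "concat L = p @ q" by (simp add: p_def q_def)
  ultimately obtain L1 L2 where L: "L = L1 @ L2" "concat L1 = p" "concat L2 = q"
    using concat_chunks_split[OF assms(1)] by blast
  have "rotate (length L1) L = L2 @ L1" unfolding L(1) by (rule rotate_append)
  then have "rotate m (concat L) = concat (rotate (length L1) L)" by (simp add: rot L(2,3))
  then show ?thesis by blast
qed

text \<open>A junction takes one unit from each of two entries. Its letter counts for the first,
  positively although it is an inverse in the group, and \<open>Carry\<close> counts for the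
  second.\<close>

fun sym_val :: "sym \<Rightarrow> int" where
  "sym_val (Sep t) = 0"
| "sym_val Carry = 1"
| "sym_val (Letter (t, k)) = (if k = Neg then -1 else 1)"

definition chunk_val :: "sym list \<Rightarrow> int" where
  "chunk_val c = sum_list (map sym_val c)"

section \<open>From a normal sequence to marked letters\<close>

definition ty :: "nat \<Rightarrow> pants_gen" where
  "ty i = (nxt ^^ i) Alpha"

lemma ty_Suc [simp]: "ty (Suc i) = nxt (ty i)"
  by (simp add: ty_def)

lemma ty_eq_iff: "ty i = ty j \<longleftrightarrow> i mod 3 = j mod 3"
proof -
  have "ty i = ty j \<longleftrightarrow> (nxt ^^ (i mod 3)) Alpha = (nxt ^^ (j mod 3)) Alpha"
    by (simp add: ty_def funpow_nxt_mod3)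
  moreover have "i mod 3 = 0 \<or> i mod 3 = 1 \<or> i mod 3 = 2" "j mod 3 = 0 \<or> j mod 3 = 1 \<or> j mod 3 = 2"
    by linarith+
  ultimately show ?thesis by (auto simp: numeral_2_eq_2)
qed

definition junc :: "(nat \<Rightarrow> int) \<Rightarrow> nat \<Rightarrow> bool" where
  "junc f i \<longleftrightarrow> f i > 0 \<and> f (Suc i) > 0"

text \<open>A junction is listed with the entry on its left: the junctions on both sides use up one
  generator each, but only the right one adds a letter. The index \<open>i - 1\<close> is the true
  predecessor only for \<open>i \<ge> 1\<close>, which the later lemmas assume.\<close>

definition letters :: "(nat \<Rightarrow> int) \<Rightarrow> nat \<Rightarrow> mletter list" where
  "letters f i =
     (if f i \<le> 0 then replicate (nat (- f i)) (ty i, Neg)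
      else replicate (nat (f i - of_bool (junc f (i - 1)) - of_bool (junc f i))) (ty i, Pos)
        @ (if junc f i then [(ty i, Junc)] else []))"

definition chunk :: "(nat \<Rightarrow> int) \<Rightarrow> nat \<Rightarrow> sym list" where
  "chunk f i = Sep (ty i) # (if junc f (i - 1) then [Carry] else []) @ map Letter (letters f i)"

lemma is_chunk_chunk: "is_chunk (chunk f i)"
  by (auto simp: is_chunk_def chunk_def)

definition last_mark :: "(nat \<Rightarrow> int) \<Rightarrow> nat \<Rightarrow> mark" where
  "last_mark f i = (if f i < 0 then Neg else if junc f i then Junc else Pos)"

text \<open>Normality of a word of length \<open>n\<close>, unrolled to a periodic sequence so that
  cyclic subwords become intervals.\<close>

locale normal_seq =
  fixes f :: "nat \<Rightarrow> int" and n :: nat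
  assumes n: "n \<noteq> 0" "3 dvd n"
    and periodic: "f (i + n) = f i"
    and one: "f (Suc i) = 1 \<Longrightarrow> f i \<le> 0 \<and> f (Suc (Suc i)) \<le> 0"
    and zero: "f (Suc i) = 0 \<Longrightarrow> f i < 0 \<and> f (Suc (Suc i)) > 0 \<or> f i > 0 \<and> f (Suc (Suc i)) \<noteq> 0"
    and no_run: "\<lbrakk>f i = 0; \<forall>j<k. f (Suc i + j) = -1; f (Suc i + k) = 0\<rbrakk> \<Longrightarrow> False"
    and not_all: "\<exists>i. f i \<noteq> -1"
begin

lemma periodic_mult: "f (i + k * n) = f i"
  by (induction k) (simp_all add: periodic add.assoc[symmetric] add.commute[of n])

lemma periodic_mod: "f (a + q mod n) = f (a + q)"
  by (metis add.assoc mod_div_mult_eq periodic_mult)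

lemma ty_add_n: "ty (i + n) = ty i"
  using n(2) by (auto simp: ty_eq_iff)

lemma junc_add_n: "junc f (i + n) = junc f i"
  using periodic[of i] periodic[of "Suc i"] by (simp add: junc_def)

text \<open>The assumption \<open>one\<close> keeps an entry 1 away from positive neighbours. Hence
  the count of plain letters in \<open>letters\<close> is never truncated by
  \<open>nat\<close>.\<close>

lemma at_least_two:
  assumes "i \<ge> 1" "f i > 0" "junc f (i - 1) \<or> junc f i"
  shows "f i \<ge> 2"
proof -
  obtain j where "i = Suc j" using assms(1) by (cases i) auto
  then show ?thesis using assms one[of j] by (cases "f i = 1") (auto simp: junc_def)
qed

lemma chunk_val_chunk:
  assumes "i \<ge> 1"
  shows "chunk_val (chunk f i) = f i"
proof (cases "f i \<le> 0")
  case True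
  have "\<not> junc f (i - 1)" using True assms by (auto simp: junc_def)
  then show ?thesis using True
    by (simp add: chunk_val_def chunk_def letters_def sum_list_replicate)
next
  case False
  then show ?thesis using at_least_two[OF assms]
    by (auto simp: chunk_val_def chunk_def letters_def sum_list_replicate)
qed

lemma spell_links_same_type:
  assumes "\<forall>z \<in> set ys. fst z = fst y"
  shows "spell (links y ys) = map Letter ys"
  using assms
proof (induction y ys rule: links.induct)
  case (2 x y ys)
  then show ?case by (cases x; cases y) auto
qed simp

lemma letters_nonzero:
  assumes "i \<ge> 1" "f i \<noteq> 0"
  obtains k ys where "letters f i = (ty i, k) # ys" "all_adj (links (ty i, k) ys)"
    "spell (links (ty i, k) ys) = map Letter ys"
    "last ((ty i, k) # ys) = (ty i, last_mark f i)"
    "k = (if f i < 0 then Neg else Pos) \<or> k = Junc \<and> f i > 0 \<and> junc f (i - 1)"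
proof -
  have rep: "all_adj (links (t, k) (replicate m (t, k)))" if "k \<noteq> Junc" for t k m
    using that by (induction m) (cases k; simp)+
  have rep_last: "last ((t, k) # replicate m (t, k)) = (t, k)" for t :: pants_gen and k :: mark and m
    by (induction m) auto
  show ?thesis
  proof (cases "f i < 0")
    case True
    then obtain m where m: "nat (- f i) = Suc m" by (cases "nat (- f i)") auto
    show ?thesis
      by (rule that[of Neg "replicate m (ty i, Neg)"])
        (use True m rep[of Neg] rep_last in \<open>auto simp: letters_def last_mark_def spell_links_same_type\<close>)
  next
    case False
    then have pos: "f i > 0" using assms by simp
    define c where "c = nat (f i - of_bool (junc f (i - 1)) - of_bool (junc f i))"
    have lets: "letters f i = replicate c (ty i, Pos) @ (if junc f i then [(ty i, Junc)] else [])"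
      using pos by (simp add: letters_def c_def)
    show ?thesis
    proof (cases c)
      case 0
      \<comment> \<open>The only positive entry without plain letters is a 2 with junctions on both
        sides.\<close>
      then have j: "junc f (i - 1)" "junc f i"
        using at_least_two[OF assms(1) pos] pos
        by (auto simp: c_def of_bool_def split: if_splits)
      show ?thesis
        by (rule that[of Junc "[]"]) (use 0 lets j pos in \<open>auto simp: last_mark_def\<close>)
    next
      case (Suc m)
      show ?thesis
      proof (cases "junc f i")
        case True
        have last: "last ((ty i, Pos) # replicate m (ty i, Pos) @ [(ty i, Junc)]) = (ty i, Junc)"
          by simp
        show ?thesis
          by (rule that[of Pos "replicate m (ty i, Pos) @ [(ty i, Junc)]"])
            (use Suc lets pos True last rep[of Pos] rep_last[of "ty i" Pos m] in
              \<open>auto simp: last_mark_def spell_links_same_type links_append simp del: last.simps\<close>)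
      next
        case False
        show ?thesis
          by (rule that[of Pos "replicate m (ty i, Pos)"])
            (use Suc lets pos False rep[of Pos] rep_last[of "ty i" Pos m] in
              \<open>auto simp: last_mark_def spell_links_same_type simp del: last.simps\<close>)
      qed
    qed
  qed
qed

lemma links_letters_Suc:
  assumes "i \<ge> 1" "f i \<noteq> 0" "f (Suc i) \<noteq> 0"
  defines "X \<equiv> (ty i, last_mark f i)"
  shows "all_adj (links X (letters f (Suc i)))"
    "spell (links X (letters f (Suc i))) = chunk f (Suc i)"
    "last (X # letters f (Suc i)) = (ty (Suc i), last_mark f (Suc i))"
proof -
  obtain k ys where ys: "letters f (Suc i) = (ty (Suc i), k) # ys"
      "all_adj (links (ty (Suc i), k) ys)"
      "spell (links (ty (Suc i), k) ys) = map Letter ys"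
      "last ((ty (Suc i), k) # ys) = (ty (Suc i), last_mark f (Suc i))"
      "k = (if f (Suc i) < 0 then Neg else Pos) \<or> k = Junc \<and> f (Suc i) > 0 \<and> junc f i"
    using letters_nonzero[of "Suc i"] assms(3) by auto
  have "adj X (ty (Suc i), k)"
    using ys(5) assms(2,3) by (auto simp: X_def last_mark_def junc_def)
  moreover have "gap X (ty (Suc i), k) = Sep (ty (Suc i)) # (if junc f i then [Carry] else [])"
    using assms(2,3) by (auto simp: X_def last_mark_def junc_def)
  ultimately show "all_adj (links X (letters f (Suc i)))"
    "spell (links X (letters f (Suc i))) = chunk f (Suc i)"
    "last (X # letters f (Suc i)) = (ty (Suc i), last_mark f (Suc i))"
    using ys by (auto simp: chunk_def)
qed

lemma links_letters_Suc_Suc: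
  assumes "i \<ge> 1" "f i \<noteq> 0" "f (Suc i) = 0"
  defines "X \<equiv> (ty i, last_mark f i)"
  shows "all_adj (links X (letters f (Suc (Suc i))))"
    "spell (links X (letters f (Suc (Suc i)))) = chunk f (Suc i) @ chunk f (Suc (Suc i))"
    "last (X # letters f (Suc (Suc i))) = (ty (Suc (Suc i)), last_mark f (Suc (Suc i)))"
proof -
  note z = zero[OF assms(3)]
  have "f (Suc (Suc i)) \<noteq> 0" using z by auto
  then obtain k ys where ys: "letters f (Suc (Suc i)) = (ty (Suc (Suc i)), k) # ys"
      "all_adj (links (ty (Suc (Suc i)), k) ys)"
      "spell (links (ty (Suc (Suc i)), k) ys) = map Letter ys"
      "last ((ty (Suc (Suc i)), k) # ys) = (ty (Suc (Suc i)), last_mark f (Suc (Suc i)))"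
      "k = (if f (Suc (Suc i)) < 0 then Neg else Pos) \<or>
        k = Junc \<and> f (Suc (Suc i)) > 0 \<and> junc f (Suc i)"
    using letters_nonzero[of "Suc (Suc i)"] by auto
  have j: "\<not> junc f i" "\<not> junc f (Suc i)" using assms(3) by (auto simp: junc_def)
  have "adj X (ty (Suc (Suc i)), k)"
    using ys(5) z j by (auto simp: X_def last_mark_def)
  moreover have "gap X (ty (Suc (Suc i)), k) = [Sep (ty (Suc i)), Sep (ty (Suc (Suc i)))]"
    by (auto simp: X_def)
  moreover have "chunk f (Suc i) = [Sep (ty (Suc i))]"
    using j assms(3) by (simp add: chunk_def letters_def)
  ultimately show "all_adj (links X (letters f (Suc (Suc i))))"
    "spell (links X (letters f (Suc (Suc i)))) = chunk f (Suc i) @ chunk f (Suc (Suc i))"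
    "last (X # letters f (Suc (Suc i))) = (ty (Suc (Suc i)), last_mark f (Suc (Suc i)))"
    using ys j by (auto simp: chunk_def[of f "Suc (Suc i)"])
qed

text \<open>The induction is strong because a zero has no letters: it is crossed together with the
  entry after it, going back to the nonzero entry before it.\<close>

lemma links_letters:
  assumes "a \<ge> 1" "f a \<noteq> 0" "f (a + k) \<noteq> 0"
  defines "X \<equiv> (ty a, last_mark f a)"
    and "L \<equiv> \<lambda>k. concat (map (letters f) [Suc a..<Suc (a + k)])"
  shows "all_adj (links X (L k)) \<and>
    spell (links X (L k)) = concat (map (chunk f) [Suc a..<Suc (a + k)]) \<and>
    last (X # L k) = (ty (a + k), last_mark f (a + k))"
  using assms(3)
proof (induction k rule: less_induct)
  case (less k)
  show ?case
  proof (cases k)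
    case 0
    then show ?thesis by (simp add: L_def X_def)
  next
    case (Suc m)
    have split: "links X (L (Suc m)) = links X (L m) @ links (last (X # L m)) (letters f (Suc (a + m)))"
      "last (X # L (Suc m)) = last (last (X # L m) # letters f (Suc (a + m)))" for m
      by (auto simp: L_def links_append)
    show ?thesis
    proof (cases "f (a + m) = 0")
      case False
      then have IH: "all_adj (links X (L m))"
          "spell (links X (L m)) = concat (map (chunk f) [Suc a..<Suc (a + m)])"
          "last (X # L m) = (ty (a + m), last_mark f (a + m))"
        using less.IH[of m] Suc by auto
      have nz: "f (Suc (a + m)) \<noteq> 0" using less.prems Suc by simp
      show ?thesis
        using IH links_letters_Suc[of "a + m", OF _ False nz] assms(1)
        unfolding Suc split IH(3) by simp
    next
      case True
      then obtain l where m: "m = Suc l" using assms(2) by (cases m) auto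
      have nz: "f (a + l) \<noteq> 0" and z: "f (Suc (a + l)) = 0" using zero[of "a + l"] True m by auto
      then have IH: "all_adj (links X (L l))"
          "spell (links X (L l)) = concat (map (chunk f) [Suc a..<Suc (a + l)])"
          "last (X # L l) = (ty (a + l), last_mark f (a + l))"
        using less.IH[of l] Suc m by auto
      have e: "letters f (Suc (a + l)) = []" using z by (simp add: letters_def)
      have Lm: "L m = L l" using e by (simp add: L_def m)
      show ?thesis
        using IH links_letters_Suc_Suc[of "a + l", OF _ nz z] assms(1)
        unfolding Suc split Lm IH(3) by (simp add: m)
    qed
  qed
qed

text \<open>The rotation and the start \<open>a\<close> are left open, so that the property survives
  rotations of \<open>x\<close>.\<close>

definition parses :: "mletter list \<Rightarrow> bool" where
  "parses x \<longleftrightarrow> x \<noteq> [] \<and> all_adj (cyc_pairs x) \<and>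
     (\<exists>m a. a \<ge> 1 \<and> rotate m (spell (cyc_pairs x)) = concat (map (chunk f) [a..<a + n]))"

lemma parses_rotate: "parses x \<Longrightarrow> parses (rotate k x)"
proof -
  assume x: "parses x"
  then obtain m a where ma: "a \<ge> 1" "rotate m (spell (cyc_pairs x)) = concat (map (chunk f) [a..<a + n])"
    by (auto simp: parses_def)
  obtain l where l: "spell (cyc_pairs (rotate k x)) = rotate l (spell (cyc_pairs x))"
    using spell_rotate cyc_pairs_rotate by metis
  obtain l' where "rotate l' (spell (cyc_pairs (rotate k x))) = spell (cyc_pairs x)"
    using rotate_inverse[of l] unfolding l by blast
  then have "rotate (m + l') (spell (cyc_pairs (rotate k x))) = concat (map (chunk f) [a..<a + n])"
    by (simp only: rotate_rotate[symmetric] ma(2))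
  then show ?thesis using x ma(1) unfolding parses_def cyc_pairs_rotate by auto
qed

lemma exists_parse:
  obtains a x where "a \<ge> 1" "parses x" "rotate1 x = concat (map (letters f) [a..<a + n])"
proof -
  \<comment> \<open>Of two consecutive entries at least one is nonzero.\<close>
  obtain a where a: "a \<ge> 1" "f a \<noteq> 0"
    using zero[of 1] by (cases "f 1 = 0") (use zero[of 0] in auto)
  define X where "X = (ty a, last_mark f a)"
  define M where "M = concat (map (letters f) [Suc a..<Suc (a + n)])"
  have fa: "f (a + n) \<noteq> 0" using a periodic by simp
  have lm: "last_mark f (a + n) = last_mark f a"
    by (simp add: last_mark_def periodic junc_add_n)
  have M: "all_adj (links X M)" "spell (links X M) = concat (map (chunk f) [Suc a..<Suc (a + n)])"
      "last (X # M) = X"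
    using links_letters[OF a fa] by (simp_all only: X_def M_def ty_add_n lm)
  have "M \<noteq> []"
  proof
    assume "M = []"
    then have "concat (map (chunk f) [Suc a..<Suc (a + n)]) = []" using M(2) by simp
    then show False using n by (auto simp: chunk_def)
  qed
  \<comment> \<open>The path through one period ends with the letter \<open>X\<close> from which it
    started, so dropping this last letter leaves a cyclic word.\<close>
  then obtain M' where M': "M = M' @ [X]" using M(3) by (metis append_butlast_last_id last_ConsR)
  have "cyc_pairs (X # M') = links X M" by (simp add: cyc_pairs_Cons M')
  then have "parses (X # M')"
    unfolding parses_def using M(1,2) by (intro conjI exI[of _ 0] exI[of _ "Suc a"]) simp_all
  moreover have "rotate1 (X # M') = concat (map (letters f) [Suc a..<Suc a + n])"
    using M' by (simp add: M_def)
  ultimately show ?thesis using that[of "Suc a"] by simp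
qed

end

section \<open>Junctions are determined by the cyclic word\<close>

text \<open>A plain letter determines its mark unless it is an inverse, which may be
  \<open>Neg\<close> or \<open>Junc\<close>. Only one order of the two is recorded; the other
  follows by exchanging the two words.\<close>

definition mismatch :: "mletter \<times> mletter \<Rightarrow> bool" where
  "mismatch p \<longleftrightarrow> snd (fst p) = Junc \<and> snd (snd p) = Neg"

definition compat :: "mletter \<times> mletter \<Rightarrow> mletter \<times> mletter \<Rightarrow> bool" where
  "compat p q \<longleftrightarrow> adj (fst p) (fst q) \<and> adj (snd p) (snd q) \<and>
     unmark (fst p) = unmark (snd p) \<and> unmark (fst q) = unmark (snd q)"

text \<open>Successive junctions have successive types, hence so have the negative letters opposite
  them: each of these begins a new entry.\<close>

lemma mismatch_compat_mismatch:
  assumes "compat p q" "mismatch p" "mismatch q"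
  shows "\<exists>t u. gap (snd p) (snd q) = [Sep t] \<and> snd q = (u, Neg)"
proof -
  obtain t where p: "p = ((t, Junc), (nxt (nxt t), Neg))"
    using assms by (cases p) (auto simp: compat_def mismatch_def)
  obtain s where q: "q = ((s, Junc), (nxt (nxt s), Neg))"
    using assms by (cases q) (auto simp: compat_def mismatch_def)
  show ?thesis using assms(1) by (auto simp: p q compat_def split: if_splits)
qed

text \<open>After a junction comes a junction or a positive letter of the next type. As
  \<open>Neg\<close> is never followed by \<open>Junc\<close>, a match must be the positive letter,
  which lies two types after the \<open>Neg\<close> letter, across a zero.\<close>

lemma mismatch_compat_match:
  assumes "compat p q" "mismatch p" "\<not> mismatch q"
  shows "\<exists>t t'. gap (snd p) (snd q) = [Sep t, Sep t']"
proof -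
  obtain t where p: "p = ((t, Junc), (nxt (nxt t), Neg))"
    using assms by (cases p) (auto simp: compat_def mismatch_def)
  obtain s k s' k' where q: "q = ((s, k), (s', k'))" by (metis prod.collapse)
  show ?thesis using assms(1,3)
    by (cases k; cases k') (auto simp: p q compat_def mismatch_def split: if_splits)
qed

text \<open>The mirror image: a match before a junction must be a positive letter of the same type,
  and the \<open>Neg\<close> letter lies two types after it.\<close>

lemma match_compat_mismatch:
  assumes "compat p q" "\<not> mismatch p" "mismatch q"
  shows "\<exists>t t' u. gap (snd p) (snd q) = [Sep t, Sep t'] \<and> snd q = (u, Neg)"
proof -
  obtain t where q: "q = ((t, Junc), (nxt (nxt t), Neg))"
    using assms by (cases q) (auto simp: compat_def mismatch_def)
  obtain s k s' k' where p: "p = ((s, k), (s', k'))" by (metis prod.collapse)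
  show ?thesis using assms(1,2)
    by (cases k; cases k') (auto simp: p q compat_def mismatch_def split: if_splits)
qed

lemma spell_Cons: "spell (p # ps) = gap (fst p) (snd p) @ Letter (snd p) # spell ps"
  by (cases p) simp

definition neg_one_chunk :: "sym list \<Rightarrow> bool" where
  "neg_one_chunk c \<longleftrightarrow> (\<exists>t u. c = [Sep t, Letter (u, Neg)])"

lemma neg_one_chunk: "neg_one_chunk c \<Longrightarrow> is_chunk c" "neg_one_chunk c \<Longrightarrow> chunk_val c = -1"
  by (auto simp: neg_one_chunk_def is_chunk_def chunk_val_def)

lemma spell_mismatch_run:
  assumes "\<forall>(p, q) \<in> set (links p (run @ [z])). compat p q" "mismatch p"
    "\<forall>q \<in> set run. mismatch q" "\<not> mismatch z"
  shows "\<exists>cs t t' u. spell (links (snd p) (map snd (run @ [z]))) = concat cs @ [Sep t, Sep t', Letter u] \<and>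
    length cs = length run \<and> (\<forall>c \<in> set cs. neg_one_chunk c)"
  using assms
proof (induction run arbitrary: p)
  case Nil
  then show ?case using mismatch_compat_match[of p z]
    by (auto simp: spell_Cons intro!: exI[of _ "[]"])
next
  case (Cons q run)
  obtain cs t t' u where IH: "spell (links (snd q) (map snd (run @ [z]))) = concat cs @ [Sep t, Sep t', Letter u]"
      "length cs = length run" "\<forall>c \<in> set cs. neg_one_chunk c"
    using Cons.IH[of q] Cons.prems by auto
  obtain s v where "gap (snd p) (snd q) = [Sep s]" "snd q = (v, Neg)"
    using mismatch_compat_mismatch[of p q] Cons.prems by auto
  then show ?case using IH
    by (intro exI[of _ "[Sep s, Letter (v, Neg)] # cs"] exI[of _ t] exI[of _ t'] exI[of _ u])
      (auto simp: spell_Cons neg_one_chunk_def)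
qed

lemma rotate_run:
  assumes "\<exists>p \<in> set ps. P p" "\<exists>p \<in> set ps. \<not> P p"
  obtains k p0 run rest where "rotate k ps = p0 # run @ rest" "\<not> P p0" "run \<noteq> []"
    "\<forall>p \<in> set run. P p" "rest = [] \<or> \<not> P (hd rest)"
proof -
  obtain xs q ys where ps: "ps = xs @ q # ys" "\<not> P q" using assms(2) by (meson split_list)
  define qs where "qs = q # ys @ xs"
  have r1: "rotate (length xs) ps = qs" by (simp add: ps qs_def rotate_append)
  have "\<exists>p \<in> set (ys @ xs). P p" using assms(1) ps by auto
  then obtain us v ws where split: "ys @ xs = us @ v # ws" "P v" "\<forall>u \<in> set us. \<not> P u"
    using split_list_first_prop[of "ys @ xs" P] by metis
  \<comment> \<open>The rotation is to start at the element just before the first one satisfying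
    \<open>P\<close>.\<close>
  define zs where "zs = v # ws @ butlast (q # us)"
  have qs: "qs = butlast (q # us) @ last (q # us) # v # ws"
    unfolding qs_def split(1) using append_butlast_last_id[of "q # us"]
    by (metis append.assoc append_Cons append_Nil list.distinct(1))
  have "rotate (length (butlast (q # us))) qs = last (q # us) # zs"
    unfolding zs_def by (subst qs, subst rotate_append) simp
  then have "rotate (length (butlast (q # us)) + length xs) ps = last (q # us) # takeWhile P zs @ dropWhile P zs"
    using r1 by (simp only: rotate_rotate[symmetric] takeWhile_dropWhile_id)
  moreover have "\<not> P (last (q # us))" using split(3) ps(2) by (metis last_in_set list.distinct(1) set_ConsD)
  moreover have "takeWhile P zs \<noteq> []" using split(2) by (simp add: zs_def)
  moreover have "dropWhile P zs = [] \<or> \<not> P (hd (dropWhile P zs))" using hd_dropWhile by blast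
  moreover have "\<forall>p \<in> set (takeWhile P zs). P p" by (auto dest: set_takeWhileD)
  ultimately show ?thesis using that by blast
qed

context normal_seq
begin

lemma chunks_rotated_nth:
  assumes "i < n"
  shows "rotate j (map (chunk f) [a..<a + n]) ! i = chunk f (a + (j + i) mod n)"
  using assms by (simp add: nth_rotate)

lemma chunk_val_rotated:
  assumes "i < n" "a \<ge> 1"
  shows "chunk_val (rotate j (map (chunk f) [a..<a + n]) ! i) = f (a + j + i)"
  unfolding chunks_rotated_nth[OF assms(1)]
  using chunk_val_chunk[of "a + (j + i) mod n"] assms(2) periodic_mod[of a "j + i"]
  by (simp add: add.assoc)

text \<open>If all letters mismatch, every entry of \<open>f\<close> is -1. Otherwise a maximal run
  of mismatches spells 0, -1, ..., -1, 0 on the side of \<open>y\<close>. Both contradict the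
  normality of \<open>f\<close>.\<close>

lemma no_mismatch:
  assumes y: "parses y" and x: "all_adj (cyc_pairs x)" and u: "map unmark x = map unmark y"
    and p: "p \<in> set (zip x y)"
  shows "\<not> mismatch p"
proof
  assume mm: "mismatch p"
  define ps where "ps = zip x y"
  have len: "length x = length y" using u by (rule map_eq_imp_length_eq)
  have fst: "map fst ps = x" and snd: "map snd ps = y" using len by (simp_all add: ps_def)
  have un: "unmark (fst q) = unmark (snd q)" if q: "q \<in> set ps" for q
  proof -
    obtain i where "i < length x" "q = (x ! i, y ! i)"
      using q len by (auto simp: ps_def set_zip)
    then show ?thesis using u len by (metis fst_conv nth_map snd_conv)
  qed
  have comp: "compat q r" if qr: "(q, r) \<in> set (cyc_pairs ps)" for q r
  proof -
    have "(fst q, fst r) \<in> set (cyc_pairs x)" "(snd q, snd r) \<in> set (cyc_pairs y)"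
      using qr by (force simp: fst[symmetric] snd[symmetric] cyc_pairs_map)+
    moreover have "q \<in> set ps" "r \<in> set ps" using set_cyc_pairsD[OF qr] by auto
    ultimately show ?thesis using x y un by (auto simp: compat_def all_adj_def parses_def)
  qed
  show False
  proof (cases "\<forall>q \<in> set ps. mismatch q")
    case True
    define L where "L = map (\<lambda>(X, Y). gap X Y @ [Letter Y]) (cyc_pairs y)"
    have L: "neg_one_chunk c" if c: "c \<in> set L" for c
    proof -
      obtain q r where qr: "(q, r) \<in> set (cyc_pairs ps)" "c = gap (snd q) (snd r) @ [Letter (snd r)]"
        using c by (auto simp: L_def snd[symmetric] cyc_pairs_map)
      then show ?thesis
        using mismatch_compat_mismatch[OF comp[OF qr(1)]] set_cyc_pairsD[OF qr(1)] True
        by (auto simp: neg_one_chunk_def)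
    qed
    obtain m a where ma: "a \<ge> 1" "rotate m (concat L) = concat (map (chunk f) [a..<a + n])"
      using y by (auto simp: parses_def spell_def L_def)
    have chunks: "\<forall>c \<in> set (map (chunk f) [a..<a + n]). is_chunk c"
      by (auto simp: is_chunk_chunk)
    have Lc: "\<forall>c \<in> set L. is_chunk c" using L neg_one_chunk by blast
    obtain j where "concat (map (chunk f) [a..<a + n]) = concat (rotate j L)"
      using concat_chunks_rotate[OF Lc, of m] at_sep_concat[OF chunks] ma by auto
    then have eq: "map (chunk f) [a..<a + n] = rotate j L"
      using concat_chunks_inject[OF chunks] Lc by simp
    have "f (a + q) = -1" for q
    proof -
      have "chunk f (a + q mod n) \<in> set (map (chunk f) [a..<a + n])" using n by simp
      then have "neg_one_chunk (chunk f (a + q mod n))" using L unfolding eq by simp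
      then have "f (a + q mod n) = -1"
        using neg_one_chunk(2) chunk_val_chunk[of "a + q mod n"] ma(1) by simp
      then show ?thesis by (simp add: periodic_mod)
    qed
    \<comment> \<open>Whole periods are added to reach the indices below \<open>a\<close>
      too.\<close>
    moreover have "f i = f (a + (i + a * n - a))" for i
    proof -
      have "a \<le> a * n" using n by simp
      then have "a + (i + a * n - a) = i + a * n" by linarith
      then show ?thesis by (simp add: periodic_mult)
    qed
    ultimately show False using not_all by metis
  next
    case False
    then obtain k p0 run rest where run: "rotate k ps = p0 # run @ rest" "\<not> mismatch p0" "run \<noteq> []"
        "\<forall>p \<in> set run. mismatch p" "rest = [] \<or> \<not> mismatch (hd rest)"
      using rotate_run[of ps mismatch] mm p unfolding ps_def by metis
    \<comment> \<open>The match that closes the run may be \<open>p0\<close> itself, reached after a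
      full turn.\<close>
    obtain z rest' where z: "rest @ [p0] = z # rest'" "\<not> mismatch z"
      using run(2,5) by (cases rest) auto
    obtain q run' where q: "run = q # run'" using run(3) by (cases run) auto
    have pairs: "set (links p0 (run @ rest @ [p0])) = set (cyc_pairs ps)"
      using cyc_pairs_rotate[of k ps] run(1) cyc_pairs_Cons[of p0 "run @ rest"] by (metis append.assoc set_rotate)
    have cyc: "cyc_pairs (rotate k y) = links (snd p0) (map snd (run @ z # rest'))"
      using arg_cong[OF run(1), of "map snd"] cyc_pairs_Cons[of "snd p0" "map snd (run @ rest)"]
        arg_cong[OF z(1), of "map snd"]
      by (simp add: rotate_map[symmetric] snd)
    have comp': "\<forall>(q, r) \<in> set (links p0 (run @ z # rest')). compat q r"
      using comp pairs unfolding z(1) by auto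
    have "\<forall>(p, r) \<in> set (links q (run' @ [z])). compat p r"
      using comp' links_append[of q "run' @ [z]" rest'] by (auto simp: q)
    then obtain cs t t' v where cs:
        "spell (links (snd q) (map snd (run' @ [z]))) = concat cs @ [Sep t, Sep t', Letter v]"
        "length cs = length run'" "\<forall>c \<in> set cs. neg_one_chunk c"
      using spell_mismatch_run[of q run' z] run(4) z(2) q by auto
    obtain s s' w where "gap (snd p0) (snd q) = [Sep s, Sep s']" "snd q = (w, Neg)"
      using match_compat_mismatch[of p0 q] comp' run(2,4) q by auto
    then have "spell (cyc_pairs (rotate k y)) =
        ([Sep s, Sep s', Letter (w, Neg)] @ concat cs @ [Sep t, Sep t', Letter v])
          @ spell (links (snd z) (map snd rest'))"
      unfolding cyc using cs(1) links_append[of "snd q" "map snd (run' @ [z])" "map snd rest'"]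
      by (simp add: q spell_Cons)
    \<comment> \<open>These are the chunks of the zero before the run, of the entries -1 and of the
      zero after it; the last is complete because \<open>Sep t'\<close> follows.\<close>
    moreover define D where "D = [Sep s] # [Sep s', Letter (w, Neg)] # cs @ [[Sep t]]"
    ultimately obtain tail where sp: "spell (cyc_pairs (rotate k y)) = concat D @ Sep t' # tail"
      by auto
    have D: "\<forall>c \<in> set D. is_chunk c"
      using cs(3) neg_one_chunk(1) by (auto simp: D_def is_chunk_def)
    obtain m a where ma: "a \<ge> 1" "rotate m (spell (cyc_pairs (rotate k y))) = concat (map (chunk f) [a..<a + n])"
      using parses_rotate[OF y, of k] by (auto simp: parses_def)
    define C where "C = map (chunk f) [a..<a + n]"
    have C: "\<forall>c \<in> set C. is_chunk c" by (auto simp: C_def is_chunk_chunk)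
    obtain m' where m': "spell (cyc_pairs (rotate k y)) = rotate m' (concat C)"
      using rotate_inverse[of m "spell (cyc_pairs (rotate k y))"] unfolding ma(2) C_def by metis
    have "at_sep (rotate m' (concat C))" unfolding m'[symmetric] sp by (simp add: D_def)
    then obtain j where "concat (rotate j C) = concat D @ Sep t' # tail"
      using concat_chunks_rotate[OF C] m' sp by metis
    then obtain L1 L2 where L: "rotate j C = L1 @ L2" "concat L1 = concat D"
      using concat_chunks_split[of "rotate j C" "concat D" "Sep t' # tail"] C by auto
    have "L1 = D"
      using L C D by (intro concat_chunks_inject) (auto, metis Un_iff set_append set_rotate)
    have val: "chunk_val (D ! i) = f (a + j + i)" if "i < length D" for i
    proof -
      have "length D \<le> n" using arg_cong[OF L(1), of length] \<open>L1 = D\<close> by (simp add: C_def)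
      then have "i < n" using that by simp
      then show ?thesis
        using chunk_val_rotated[of i a j] ma(1) L(1) \<open>L1 = D\<close> that by (simp add: C_def nth_append)
    qed
    have lenD: "length D = length cs + 3" by (simp add: D_def)
    have 0: "f (a + j) = 0" using val[of 0] by (simp add: D_def chunk_val_def)
    have 1: "f (Suc (a + j) + i) = -1" if "i < Suc (length cs)" for i
    proof -
      have "D ! Suc i \<in> set ([Sep s', Letter (w, Neg)] # cs)"
        using that by (cases i) (auto simp: D_def nth_append)
      then have "chunk_val (D ! Suc i) = -1"
        using cs(3) neg_one_chunk(2) by (auto simp: chunk_val_def)
      then show ?thesis using val[of "Suc i"] that lenD by simp
    qed
    have 2: "f (Suc (a + j) + Suc (length cs)) = 0"
      using val[of "Suc (Suc (length cs))"] lenD by (simp add: D_def chunk_val_def nth_append)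
    show False using no_run[OF 0 _ 2] 1 by blast
  qed
qed

end

section \<open>Uniqueness of normal words\<close>

lemma pclass_append: "pclass (u @ v) = pclass u \<cdot> pclass v"
  by (simp add: mult_pants_group)

lemma pclass_closed [simp]: "pclass u \<in> carrier \<pi>\<^sub>P"
  by (simp add: carrier_pants_group)

lemma pclass_letter: "pclass [(t, s)] = gen_pow t (if s then 1 else -1)"
proof -
  have 1: "pclass [(t, True)] = gen_pow t 1"
    by (simp add: gen_pow_def pants_elem_closed) (simp add: pants_elem_def)
  have "pclass [(t, False)] = inv\<^bsub>\<pi>\<^sub>P\<^esub> pclass [(t, True)]"
    by (simp add: inv_pants_group inv_word_def)
  then show ?thesis using 1 by (simp add: inv_gen_pow)
qed

lemma pclass_Cons: "pclass ((t, s) # u) = gen_pow t (if s then 1 else -1) \<cdot> pclass u"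
  using pclass_append[of "[(t, s)]" u] by (simp add: pclass_letter)

lemma pclass_Nil: "pclass [] = \<one>\<^bsub>\<pi>\<^sub>P\<^esub>"
  by (simp add: one_pants_group)

lemma pclass_replicate: "pclass (replicate k (t, s)) = gen_pow t (if s then int k else - int k)"
  by (induction k) (simp_all add: pclass_Nil pclass_Cons add.commute)

lemma conj_class_pclass_rotate:
  "conj_class \<pi>\<^sub>P (pclass (rotate k u)) = conj_class \<pi>\<^sub>P (pclass u)"
proof -
  have "rotate k u = drop (k mod length u) u @ take (k mod length u) u"
    by (rule rotate_drop_take)
  then have "conj_class \<pi>\<^sub>P (pclass (rotate k u)) =
      conj_class \<pi>\<^sub>P (pclass (take (k mod length u) u) \<cdot> pclass (drop (k mod length u) u))"
    by (simp add: pclass_append pants.conj_class_mult_commute)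
  then show ?thesis by (simp add: pclass_append[symmetric])
qed

lemma cyc_reduced_unmark: "all_adj (cyc_pairs x) \<Longrightarrow> cyc_reduced (map unmark x)"
  unfolding cyc_reduced_def cyc_pairs_def[symmetric] cyc_pairs_map all_adj_def set_map
proof (rule ballI)
  fix p assume x: "\<forall>(X, Y) \<in> set (cyc_pairs x). adj X Y"
    and "p \<in> map_prod unmark unmark ` set (cyc_pairs x)"
  then obtain X Y where "p = (unmark X, unmark Y)" "(X, Y) \<in> set (cyc_pairs x)"
    by (metis imageE map_prod_simp prod.collapse)
  then show "case p of (x, y) \<Rightarrow> last (refl_letter x) \<noteq> hd (refl_letter y)"
    using x adj_reduced[of X Y] by blast
qed

context normal_seq
begin

text \<open>A junction is the product of one generator of its own type and one of the next. The
  second factor is handed on to the following entry, which has one generator fewer.\<close>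

lemma pclass_letters:
  assumes "i \<ge> 1"
  shows "pclass (map unmark (letters f i)) =
    gen_pow (ty i) (f i - of_bool (junc f (i - 1))) \<cdot> gen_pow (ty (Suc i)) (of_bool (junc f i))"
proof (cases "f i \<le> 0")
  case True
  then have "\<not> junc f (i - 1)" "\<not> junc f i" using assms by (auto simp: junc_def)
  then show ?thesis using True by (simp add: letters_def pclass_replicate)
next
  case False
  define c where "c = nat (f i - of_bool (junc f (i - 1)) - of_bool (junc f i))"
  have c: "int c = f i - of_bool (junc f (i - 1)) - of_bool (junc f i)"
    using False at_least_two[OF assms] by (auto simp: c_def)
  have "letters f i = replicate c (ty i, Pos) @ (if junc f i then [(ty i, Junc)] else [])"
    using False unfolding letters_def c_def by (rule if_not_P)
  then have "pclass (map unmark (letters f i)) =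
      gen_pow (ty i) (int c) \<cdot> pclass (if junc f i then [(nxt (nxt (ty i)), False)] else [])"
    by (simp add: pclass_append pclass_replicate)
  also have "pclass (if junc f i then [(nxt (nxt (ty i)), False)] else []) =
      gen_pow (ty i) (of_bool (junc f i)) \<cdot> gen_pow (ty (Suc i)) (of_bool (junc f i))"
    by (simp add: pclass_letter pclass_Nil gen_pow_neg_one)
  finally show ?thesis by (simp add: c)
qed

text \<open>The product telescopes: what a block hands on is what the next block lacks, so only
  corrections at the two ends survive.\<close>

lemma pclass_concat_letters:
  assumes "a \<ge> 1"
  shows "pclass (map unmark (concat (map (letters f) [a..<a + k]))) =
    gen_pow (ty a) (- of_bool (junc f (a - 1))) \<cdot> word_prod (ty a) (map f [a..<a + k])
      \<cdot> gen_pow (ty (a + k)) (of_bool (junc f (a + k - 1)))"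
proof (induction k)
  case 0
  show ?case by (simp add: pclass_Nil)
next
  case (Suc k)
  have t: "(nxt ^^ k) (ty a) = ty (a + k)"
    unfolding ty_def by (metis add.commute comp_apply funpow_add)
  show ?case
    using Suc pclass_letters[of "a + k"] assms
    by (simp add: pclass_append word_prod_append t pants.m_assoc)
qed

text \<open>Over a full period the two end corrections are mutually inverse and cancel under
  conjugation.\<close>

lemma conj_class_letters:
  assumes "a \<ge> 1"
  shows "conj_class \<pi>\<^sub>P (pclass (map unmark (concat (map (letters f) [a..<a + n])))) =
    word_conj (ty a) (map f [a..<a + n])"
proof -
  have "a + n - 1 = a - 1 + n" using assms by simp
  then have j: "junc f (a + n - 1) = junc f (a - 1)" using junc_add_n by metis
  show ?thesis
    unfolding pclass_concat_letters[OF assms] j ty_add_n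
    by (subst pants.conj_class_mult_commute) (simp_all add: word_conj_def pants.m_assoc)
qed

text \<open>Unique decomposition into chunks turns the common spelling into equal entries up to a
  shift, and the types in the separators make the shift a multiple of three.\<close>

lemma parses_inject_shift:
  assumes "normal_seq g m" "parses x" "normal_seq.parses g m x"
  shows "m = n \<and> (\<exists>d. 3 dvd d \<and> (\<forall>i. g i = f (i + d)))"
proof -
  interpret g: normal_seq g m by fact
  define S where "S = spell (cyc_pairs x)"
  obtain l a where a: "a \<ge> 1" "rotate l S = concat (map (chunk f) [a..<a + n])"
    using assms(2) by (auto simp: parses_def S_def)
  obtain l' b where b: "b \<ge> 1" "rotate l' S = concat (map (chunk g) [b..<b + m])"
    using assms(3) by (auto simp: g.parses_def S_def)
  have Cf: "\<forall>c \<in> set (map (chunk f) [a..<a + n]). is_chunk c"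
    and Cg: "\<forall>c \<in> set (map (chunk g) [b..<b + m]). is_chunk c"
    by (auto simp: is_chunk_chunk)
  obtain k where "rotate k (concat (map (chunk f) [a..<a + n])) = concat (map (chunk g) [b..<b + m])"
    using rotate_inverse[of l S] rotate_rotate unfolding a(2) b(2)[symmetric] by metis
  then obtain j where "concat (map (chunk g) [b..<b + m]) = concat (rotate j (map (chunk f) [a..<a + n]))"
    using concat_chunks_rotate[OF Cf] at_sep_concat[OF Cg] by metis
  then have eq: "map (chunk g) [b..<b + m] = rotate j (map (chunk f) [a..<a + n])"
    by (intro concat_chunks_inject[OF Cg]) (use Cf in auto)
  have m: "m = n" using arg_cong[OF eq, of length] by simp
  have chunk: "chunk g (b + i) = rotate j (map (chunk f) [a..<a + n]) ! i" if "i < n" for i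
    using arg_cong[OF eq, of "\<lambda>L. L ! i"] that m by simp
  have "g (b + i) = f (a + j + i)" if "i < n" for i
    using chunk[OF that] chunk_val_rotated[OF that a(1), of j] g.chunk_val_chunk[of "b + i"] b(1) by simp
  then have "g (b + i mod n) = f (a + j + i mod n)" for i
    using n by simp
  then have val: "g (b + i) = f (a + j + i)" for i
    using g.periodic_mod[of b i] periodic_mod[of "a + j" i] by (simp add: m)
  have "chunk g b = chunk f (a + j mod n)"
    using chunk[of 0] n chunks_rotated_nth[of 0 j a] by simp
  then have "ty b = ty (a + j mod n)" by (simp add: chunk_def)
  moreover have "(a + j mod n) mod 3 = (a + j) mod 3"
    using n(2) by (metis mod_add_right_eq mod_mod_cancel)
  ultimately have t: "b mod 3 = (a + j) mod 3" by (simp add: ty_eq_iff)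
  \<comment> \<open>The offset \<open>a + j - b\<close>, with whole periods added so that it is a
    natural number.\<close>
  define d where "d = a + j + b * n - b"
  have bn: "b \<le> b * n" using n by simp
  have "g i = f (i + d)" for i
  proof -
    have "g i = g (b + (i + b * n - b))"
      using g.periodic_mult[of i b] bn m by (simp add: le_add_diff_inverse trans_le_add2)
    also have "\<dots> = f (a + j + (i + b * n - b))" by (rule val)
    also have "a + j + (i + b * n - b) = i + d" using bn unfolding d_def by linarith
    finally show ?thesis .
  qed
  moreover have "3 dvd d"
  proof -
    obtain q where "n = 3 * q" using n(2) by (rule dvdE)
    moreover have "d + b = a + j + b * n" using bn unfolding d_def by linarith
    ultimately have "d + b = a + j + 3 * (b * q)" by simp
    then show ?thesis using t by presburger
  qed
  ultimately show ?thesis using m by blast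
qed

end

text \<open>The marks could differ only by \<open>Neg\<close> against \<open>Junc\<close>;
  \<open>no_mismatch\<close>, applied in both directions, excludes this.\<close>

lemma parses_unmark_inject:
  assumes "normal_seq f n" "normal_seq g m" "normal_seq.parses f n x" "normal_seq.parses g m y"
    "map unmark x = map unmark y"
  shows "x = y"
proof (rule nth_equalityI)
  show len: "length x = length y" using assms(5) by (rule map_eq_imp_length_eq)
  fix i assume i: "i < length x"
  have adj: "all_adj (cyc_pairs x)" "all_adj (cyc_pairs y)"
    using assms by (auto simp: normal_seq.parses_def)
  have "(x ! i, y ! i) \<in> set (zip x y)" "(y ! i, x ! i) \<in> set (zip y x)"
    using i len by (auto simp: set_zip)
  then have "\<not> mismatch (x ! i, y ! i)" "\<not> mismatch (y ! i, x ! i)"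
    using normal_seq.no_mismatch[OF assms(2,4) adj(1) assms(5)]
      normal_seq.no_mismatch[OF assms(1,3) adj(2) assms(5)[symmetric]] by blast+
  moreover have "unmark (x ! i) = unmark (y ! i)"
    using arg_cong[OF assms(5), of "\<lambda>s. s ! i"] i len by simp
  ultimately show "x ! i = y ! i"
    by (cases "x ! i" rule: unmark.cases; cases "y ! i" rule: unmark.cases) (auto simp: mismatch_def)
qed

definition word_seq :: "int list \<Rightarrow> nat \<Rightarrow> int" where
  "word_seq w i = w ! (i mod length w)"

lemma normal_seq_word_seq:
  assumes "3 dvd length w" "w \<noteq> []" "normal w"
  shows "normal_seq (word_seq w) (length w)"
proof
  have sub: "subword [word_seq w i, word_seq w (Suc i), word_seq w (Suc (Suc i))] w" for i
    using subword_nth3[of w i] by (simp add: word_seq_def)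
  show "length w \<noteq> 0" "3 dvd length w" using assms by auto
  show "word_seq w (i + length w) = word_seq w i" for i by (simp add: word_seq_def)
  show "word_seq w i \<le> 0 \<and> word_seq w (Suc (Suc i)) \<le> 0" if "word_seq w (Suc i) = 1" for i
    using sub[of i] that assms(3) unfolding normal_def by metis
  show "word_seq w i < 0 \<and> word_seq w (Suc (Suc i)) > 0 \<or>
      word_seq w i > 0 \<and> word_seq w (Suc (Suc i)) \<noteq> 0" if "word_seq w (Suc i) = 0" for i
  proof -
    have "subword [word_seq w i, 0, word_seq w (Suc (Suc i))] w" using sub[of i] that by simp
    then have "(word_seq w i \<le> -1 \<and> word_seq w (Suc (Suc i)) \<ge> 1) \<or>
      (word_seq w i \<ge> 1 \<and> word_seq w (Suc (Suc i)) \<le> -1) \<or>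
      (word_seq w i \<ge> 1 \<and> word_seq w (Suc (Suc i)) \<ge> 1)"
      using assms(3) unfolding normal_def by blast
    then show ?thesis by linarith
  qed
  show False if run: "word_seq w i = 0" "\<forall>j<k. word_seq w (Suc i + j) = -1" "word_seq w (Suc i + k) = 0" for i k
  proof -
    have "([0] @ replicate k (-1) @ [0]) ! j = w ! ((i + j) mod length w)"
      if j: "j < length ([0::int] @ replicate k (-1) @ [0])" for j
    proof -
      consider "j = 0" | l where "j = Suc l" "l < k" | "j = Suc k" using j by (cases j) fastforce+
      then have "([0] @ replicate k (-1) @ [0]) ! j = word_seq w (i + j)"
        by cases (use run in \<open>simp_all add: nth_append\<close>)
      then show ?thesis by (simp add: word_seq_def)
    qed
    then have "subword ([0] @ replicate k (-1) @ [0]) w" unfolding subword_iff by blast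
    then show False using assms(3) unfolding normal_def by blast
  qed
  show "\<exists>i. word_seq w i \<noteq> -1"
  proof (rule ccontr)
    assume "\<nexists>i. word_seq w i \<noteq> -1"
    then have "w ! i = -1" if "i < length w" for i
      using that by (metis mod_less word_seq_def)
    then have "w = replicate (length w) (-1)" by (intro nth_equalityI) simp_all
    then show False using assms(3) unfolding normal_def by blast
  qed
qed

lemma loop_word_iff: "loop_word w \<longleftrightarrow> 3 dvd length w \<and> w \<noteq> []"
proof
  assume "3 dvd length w \<and> w \<noteq> []"
  then obtain q where q: "length w = 3 * q" "w \<noteq> []" by (auto elim: dvdE)
  then have "q \<noteq> 0" by (cases q) auto
  then show "loop_word w" unfolding loop_word_def using q by (intro exI[of _ q]) simp
next
  assume "loop_word w"
  then obtain q where "q \<ge> 1" "length w = 3 * q" by (auto simp: loop_word_def)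
  then show "3 dvd length w \<and> w \<noteq> []" by auto
qed

lemma loop_class_parse:
  assumes "loop_word w" "normal w"
  obtains x where "normal_seq.parses (word_seq w) (length w) x"
    "conj_class \<pi>\<^sub>P (pclass (map unmark x)) = loop_class w"
proof -
  have w: "3 dvd length w" "w \<noteq> []" using assms(1) by (auto simp: loop_word_iff)
  interpret normal_seq "word_seq w" "length w" using w assms(2) by (rule normal_seq_word_seq)
  obtain a x where x: "a \<ge> 1" "parses x" "rotate1 x = concat (map (letters (word_seq w)) [a..<a + length w])"
    using exists_parse by blast
  have "map (word_seq w) [a..<a + length w] = rotate a w"
    by (rule nth_equalityI) (simp_all add: nth_rotate word_seq_def)
  then have "word_conj (ty a) (map (word_seq w) [a..<a + length w]) = loop_class w"
    using word_conj_rotate[OF w(1), of a Alpha] by (simp add: ty_def loop_class_eq_word_conj w(1))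
  then have "conj_class \<pi>\<^sub>P (pclass (map unmark (rotate1 x))) = loop_class w"
    using conj_class_letters[OF x(1)] x(3) by simp
  then have "conj_class \<pi>\<^sub>P (pclass (map unmark x)) = loop_class w"
    using conj_class_pclass_rotate[of 1 "map unmark x"] by (simp add: rotate1_map)
  then show ?thesis using that x(2) by blast
qed

lemma one_shift_funpow: "(one_shift ^^ k) w = rotate (3 * k) w"
  by (induction k) (simp_all add: one_shift_def rotate_rotate)

lemma normal_unique:
  assumes "loop_word w" "normal w" "loop_word v" "normal v" "loop_class w = loop_class v"
  shows "equal_up_to_shifting w v"
proof -
  obtain x where x: "normal_seq.parses (word_seq w) (length w) x"
      "conj_class \<pi>\<^sub>P (pclass (map unmark x)) = loop_class w"
    using loop_class_parse[OF assms(1,2)] .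
  obtain y where y: "normal_seq.parses (word_seq v) (length v) y"
      "conj_class \<pi>\<^sub>P (pclass (map unmark y)) = loop_class v"
    using loop_class_parse[OF assms(3,4)] .
  interpret w: normal_seq "word_seq w" "length w"
    using assms(1,2) normal_seq_word_seq loop_word_iff by blast
  interpret v: normal_seq "word_seq v" "length v"
    using assms(3,4) normal_seq_word_seq loop_word_iff by blast
  have "cyc_reduced (map unmark x)" "cyc_reduced (map unmark y)"
    using x(1) y(1) cyc_reduced_unmark by (auto simp: w.parses_def v.parses_def)
  then obtain k where "map unmark y = rotate k (map unmark x)"
    using conj_class_cyc_reduced[of "map unmark x" "map unmark y"] x(2) y(2) assms(5) by metis
  then have "rotate k x = y"
    using parses_unmark_inject[OF w.normal_seq_axioms v.normal_seq_axioms w.parses_rotate[OF x(1)] y(1)]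
    by (simp add: rotate_map)
  then have "v.parses (rotate k x)" using y(1) by simp
  then obtain d where len: "length v = length w" and d: "3 dvd d" "\<And>i. word_seq v i = word_seq w (i + d)"
    using w.parses_inject_shift[OF v.normal_seq_axioms w.parses_rotate[OF x(1)]] by blast
  have "v = rotate d w"
  proof (rule nth_equalityI)
    fix i assume "i < length v"
    then show "v ! i = rotate d w ! i"
      using d(2)[of i] len by (simp add: nth_rotate word_seq_def add.commute)
  qed (simp add: len)
  then show ?thesis using d(1) unfolding equal_up_to_shifting_def one_shift_funpow by (auto elim: dvdE)
qed

section \<open>Normal words give essential classes, and every element comes from a loop word\<close>

lemma adj_unmark_eq: "adj X Y \<Longrightarrow> unmark X = unmark Y \<Longrightarrow> gap X Y = []"
  by (cases X rule: unmark.cases; cases Y rule: unmark.cases) (auto split: if_splits)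

text \<open>The cyclically reduced word of a power repeats one letter, so its spelling contains no
  separator, while every entry of \<open>w\<close> contributes one.\<close>

lemma normal_not_gen_pow:
  assumes "loop_word w" "normal w"
  shows "loop_class w \<noteq> conj_class \<pi>\<^sub>P (gen_pow t k)"
proof
  assume eq: "loop_class w = conj_class \<pi>\<^sub>P (gen_pow t k)"
  obtain x where x: "normal_seq.parses (word_seq w) (length w) x"
      "conj_class \<pi>\<^sub>P (pclass (map unmark x)) = loop_class w"
    using loop_class_parse[OF assms] .
  interpret normal_seq "word_seq w" "length w"
    using assms normal_seq_word_seq loop_word_iff by blast
  define z where "z = (t, k \<ge> 0)"
  define u where "u = replicate (nat \<bar>k\<bar>) z"
  have "conj_class \<pi>\<^sub>P (pclass u) = conj_class \<pi>\<^sub>P (pclass (map unmark x))"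
    using eq x(2) by (simp add: u_def z_def pclass_replicate)
  moreover have "cyc_reduced u"
    by (cases "k \<ge> 0") (auto simp: cyc_reduced_def u_def z_def set_zip)
  moreover have "cyc_reduced (map unmark x)"
    using x(1) cyc_reduced_unmark by (auto simp: parses_def)
  ultimately obtain l where "map unmark x = rotate l u"
    using conj_class_cyc_reduced by blast
  then have "set (map unmark x) \<subseteq> {z}" by (auto simp: u_def)
  then have un: "unmark X = z" if "X \<in> set x" for X using that by auto
  have "gap X Y = []" if "(X, Y) \<in> set (cyc_pairs x)" for X Y
    using that x(1) un[OF set_cyc_pairsD(1)[OF that]] un[OF set_cyc_pairsD(2)[OF that]]
    by (intro adj_unmark_eq) (auto simp: parses_def all_adj_def)
  then have "Sep s \<notin> set (spell (cyc_pairs x))" for s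
    by (fastforce simp: spell_def simp del: gap.simps)
  moreover obtain m a where ma: "rotate m (spell (cyc_pairs x)) = concat (map (chunk (word_seq w)) [a..<a + length w])"
    using x(1) by (auto simp: parses_def)
  have "Sep (ty a) \<in> set (concat (map (chunk (word_seq w)) [a..<a + length w]))"
    using n by (auto simp: chunk_def intro!: bexI[of _ a])
  ultimately show False unfolding ma[symmetric] by simp
qed

lemma word_prod_surj: "\<exists>w. 3 dvd length w \<and> w \<noteq> [] \<and> pclass u = word_prod Alpha w"
proof (induction u)
  case Nil
  show ?case by (rule exI[of _ "[0, 0, 0]"]) (simp add: pclass_Nil)
next
  case (Cons x u)
  then obtain w where w: "3 dvd length w" "w \<noteq> []" "pclass u = word_prod Alpha w" by blast
  obtain t s where x: "x = (t, s)" by force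
  define e :: int where "e = (if s then 1 else -1)"
  have "pclass (x # u) = gen_pow t e \<cdot> word_prod Alpha w" by (simp add: x pclass_Cons w(3) e_def)
  then have "pclass (x # u) = word_prod Alpha
      ((case t of Alpha \<Rightarrow> [e, 0, 0] | Beta \<Rightarrow> [0, e, 0] | Gamma \<Rightarrow> [0, 0, e]) @ w)"
    by (cases t) simp_all
  then show ?case using w(1) by (intro exI conjI) (auto split: pants_gen.split)
qed

theorem theorem1p7:
  shows "(\<forall>C\<in>loop_classes. essential C \<longrightarrow>
            (\<exists>w. loop_word w \<and> normal w \<and> C = loop_class w \<and>
               (\<forall>v. loop_word v \<and> normal v \<and> C = loop_class v \<longrightarrow> equal_up_to_shifting w v)))
       \<and> (\<forall>w. loop_word w \<and> normal w \<longrightarrow> essential (loop_class w))"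
proof (intro conjI ballI allI impI)
  fix C assume C: "C \<in> loop_classes" "essential C"
  then obtain u where u: "C = conj_class \<pi>\<^sub>P (pclass u)"
    by (auto simp: loop_classes_def conj_classes_def carrier_pants_group)
  obtain w where w: "3 dvd length w" "w \<noteq> []" "C = word_conj Alpha w"
    using word_prod_surj[of u] u by (auto simp: word_conj_def)
  obtain s v where v: "3 dvd length v" "v \<noteq> []" "normal v" "word_conj s v = C"
    using exists_normal[of w Alpha] w C(2) by auto
  \<comment> \<open>The normal word may begin with another generator; a rotation makes it begin with
    \<alpha>.\<close>
  obtain k where "(nxt ^^ k) s = Alpha"
  proof (cases s)
    case Alpha
    then show ?thesis using that[of 0] by simp
  next
    case Beta
    then show ?thesis using that[of 2] by (simp add: numeral_2_eq_2)
  next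
    case Gamma
    then show ?thesis using that[of 1] by simp
  qed
  then have "C = loop_class (rotate k v)"
    using word_conj_rotate[OF v(1), of k s] v(1,4) by (simp add: loop_class_eq_word_conj)
  moreover have "loop_word (rotate k v)" "normal (rotate k v)"
    using v(1-3) by (simp_all add: loop_word_iff normal_rotate)
  ultimately show "\<exists>w. loop_word w \<and> normal w \<and> C = loop_class w \<and>
      (\<forall>v. loop_word v \<and> normal v \<and> C = loop_class v \<longrightarrow> equal_up_to_shifting w v)"
    using normal_unique by blast
next
  fix w assume "loop_word w \<and> normal w"
  then show "essential (loop_class w)"
    using normal_not_gen_pow by (auto simp: essential_def gen_pow_def)
qed

end
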